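(* Let $\Omega\subset\mathbb{R}^n$ be an open and bounded domain, and let $0\ne u\in W^{1,\infty}_0(\Omega)$ be an eigenfunction, $\lambda u\in\partial\mathcal{J}(u)$ with some $\lambda>0$, such that $\lambda u=-\operatorname{div} q$ for some $q\in H(\operatorname{div};\Omega)$ with $\|q\|_1=1$. Assume that the set $\{u\neq 0\}=\{x\in\Omega:u(x)\ne0\}$ has a Lipschitz boundary. Then the nodal set $N(u)=\{x\in\Omega: u(x)=0\}$ has zero Lebesgue measure, $|N(u)|=0$.
   Context: $W^{1,\infty}_0(\Omega)=\{u\in W^{1,\infty}(\Omega): u=0\text{ on }\partial\Omega\}$ (Lipschitz functions vanishing on $\partial\Omega$). $\mathcal{J}:L^2(\Omega)\to[0,\infty]$ is $\mathcal{J}(u)=\|\nabla u\|_\infty$ if $u\in W^{1,\infty}_0(\Omega)$ and $+\infty$ otherwise. $\partial\mathcal{J}(u)=\{\zeta\in L^2(\Omega): \langle\zeta,v\rangle\le\mathcal{J}(v)\ \forall v\in L^2(\Omega),\ \langle\zeta,u\rangle=\mathcal{J}(u)\}$ with $\langle\cdot,\cdot\rangle$ the $L^2(\Omega)$ inner product. $H(\operatorname{div};\Omega)$ is the space of vector fields $q\in L^2(\Omega)$ (with values in $\mathbb{R}^n$) whose distributional divergence lies in $L^2(\Omega)$. $\|q\|_1=\int_\Omega|q|\,\mathrm{d}x$. *)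

theory Defs
  imports "HOL-Analysis.Analysis" "HOL-Probability.Essential_Supremum"
begin

section \<open>Test functions\<close>

definition partial_deriv :: "'n::finite \<Rightarrow> (real^'n \<Rightarrow> real) \<Rightarrow> real^'n \<Rightarrow> real" where
  "partial_deriv i f x = frechet_derivative f (at x) (axis i 1)"

definition grad :: "(real^'n::finite \<Rightarrow> real) \<Rightarrow> real^'n \<Rightarrow> real^'n" where
  "grad f x = (\<chi> i. partial_deriv i f x)"

primrec C_k :: "nat \<Rightarrow> (real^'n::finite \<Rightarrow> real) \<Rightarrow> bool" where
  "C_k 0 f \<longleftrightarrow> continuous_on UNIV f"
| "C_k (Suc k) f \<longleftrightarrow> (\<forall>x. f differentiable (at x)) \<and> (\<forall>i. C_k k (partial_deriv i f))"

definition test_functions :: "(real^'n::finite) set \<Rightarrow> (real^'n \<Rightarrow> real) set" where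
  "test_functions \<Omega> =
     {\<phi>. (\<forall>k. C_k k \<phi>) \<and> compact (closure {x. \<phi> x \<noteq> 0}) \<and> closure {x. \<phi> x \<noteq> 0} \<subseteq> \<Omega>}"

section \<open>Lebesgue spaces\<close>

text \<open>Elements of these spaces are genuine functions on the whole of \<open>\<real>\<^sup>n\<close>; only their values
  on \<open>\<Omega>\<close> matter, and functions that agree almost everywhere are not identified.\<close>

definition L2 :: "(real^'n::finite) set \<Rightarrow> (real^'n \<Rightarrow> 'b::euclidean_space) set" where
  "L2 \<Omega> = {f. f \<in> borel_measurable (lebesgue_on \<Omega>) \<and>
              integrable (lebesgue_on \<Omega>) (\<lambda>x. (norm (f x))\<^sup>2)}"

definition L2_inner :: "(real^'n::finite) set \<Rightarrow> (real^'n \<Rightarrow> real) \<Rightarrow> (real^'n \<Rightarrow> real) \<Rightarrow> real" where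
  "L2_inner \<Omega> f g = (LINT x|lebesgue_on \<Omega>. f x * g x)"

definition L1_norm :: "(real^'n::finite) set \<Rightarrow> (real^'n \<Rightarrow> 'b::euclidean_space) \<Rightarrow> real" where
  "L1_norm \<Omega> f = (LINT x|lebesgue_on \<Omega>. norm (f x))"

definition Linf_norm :: "(real^'n::finite) set \<Rightarrow> (real^'n \<Rightarrow> 'b::euclidean_space) \<Rightarrow> ereal" where
  "Linf_norm \<Omega> f = esssup (lebesgue_on \<Omega>) (\<lambda>x. ereal (norm (f x)))"

definition Linf :: "(real^'n::finite) set \<Rightarrow> (real^'n \<Rightarrow> 'b::euclidean_space) set" where
  "Linf \<Omega> = {f. f \<in> borel_measurable (lebesgue_on \<Omega>) \<and> Linf_norm \<Omega> f < \<infinity>}"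

definition locally_integrable ::
  "(real^'n::finite) set \<Rightarrow> (real^'n \<Rightarrow> 'b::euclidean_space) \<Rightarrow> bool" where
  "locally_integrable \<Omega> f \<longleftrightarrow> (\<forall>K. compact K \<and> K \<subseteq> \<Omega> \<longrightarrow> f absolutely_integrable_on K)"

section \<open>Weak gradient and distributional divergence\<close>

text \<open>Local integrability is required explicitly because the Bochner integral of a
  non-integrable function is \<open>0\<close>.\<close>

definition is_weak_grad ::
  "(real^'n::finite) set \<Rightarrow> (real^'n \<Rightarrow> real) \<Rightarrow> (real^'n \<Rightarrow> real^'n) \<Rightarrow> bool" where
  "is_weak_grad \<Omega> u g \<longleftrightarrow>
     locally_integrable \<Omega> u \<and> locally_integrable \<Omega> g \<and>
     (\<forall>\<phi>\<in>test_functions \<Omega>. \<forall>i.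
        (LINT x|lebesgue_on \<Omega>. u x * partial_deriv i \<phi> x) = - (LINT x|lebesgue_on \<Omega>. g x $ i * \<phi> x))"

text \<open>A representative of the weak gradient, which is unique up to null sets on an open set.\<close>

definition weak_grad :: "(real^'n::finite) set \<Rightarrow> (real^'n \<Rightarrow> real) \<Rightarrow> real^'n \<Rightarrow> real^'n" where
  "weak_grad \<Omega> u = (SOME g. is_weak_grad \<Omega> u g)"

definition is_weak_div ::
  "(real^'n::finite) set \<Rightarrow> (real^'n \<Rightarrow> real^'n) \<Rightarrow> (real^'n \<Rightarrow> real) \<Rightarrow> bool" where
  "is_weak_div \<Omega> q d \<longleftrightarrow>
     locally_integrable \<Omega> q \<and> locally_integrable \<Omega> d \<and>
     (\<forall>\<phi>\<in>test_functions \<Omega>.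
        (LINT x|lebesgue_on \<Omega>. q x \<bullet> grad \<phi> x) = - (LINT x|lebesgue_on \<Omega>. d x * \<phi> x))"

definition H_div :: "(real^'n::finite) set \<Rightarrow> (real^'n \<Rightarrow> real^'n) set" where
  "H_div \<Omega> = {q \<in> L2 \<Omega>. \<exists>d\<in>L2 \<Omega>. is_weak_div \<Omega> q d}"

section \<open>The functional and its subdifferential\<close>

definition W1inf :: "(real^'n::finite) set \<Rightarrow> (real^'n \<Rightarrow> real) set" where
  "W1inf \<Omega> = {u \<in> Linf \<Omega>. \<exists>g\<in>Linf \<Omega>. is_weak_grad \<Omega> u g}"

text \<open>The boundary condition refers to the representative that is continuous up to the boundary.
  The members are exactly the functions that are Lipschitz on the closure and vanish on the
  boundary, so pointwise notions such as the nodal set make sense for them.\<close>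

definition W01inf :: "(real^'n::finite) set \<Rightarrow> (real^'n \<Rightarrow> real) set" where
  "W01inf \<Omega> = {u \<in> W1inf \<Omega>. continuous_on (closure \<Omega>) u \<and> (\<forall>x\<in>frontier \<Omega>. u x = 0)}"

text \<open>Finiteness is decided for the almost-everywhere class of the argument.\<close>

definition J_fun :: "(real^'n::finite) set \<Rightarrow> (real^'n \<Rightarrow> real) \<Rightarrow> ereal" where
  "J_fun \<Omega> v =
     (if \<exists>w\<in>W01inf \<Omega>. AE x in lebesgue_on \<Omega>. v x = w x
      then Linf_norm \<Omega> (weak_grad \<Omega> v) else \<infinity>)"

definition subdiff_J :: "(real^'n::finite) set \<Rightarrow> (real^'n \<Rightarrow> real) \<Rightarrow> (real^'n \<Rightarrow> real) set" where
  "subdiff_J \<Omega> u =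
     {\<zeta> \<in> L2 \<Omega>. (\<forall>v\<in>L2 \<Omega>. ereal (L2_inner \<Omega> \<zeta> v) \<le> J_fun \<Omega> v) \<and>
                 ereal (L2_inner \<Omega> \<zeta> u) = J_fun \<Omega> u}"

section \<open>Lipschitz boundary\<close>

text \<open>Near each boundary point the set is, in the direction of some unit vector \<open>e\<close>, the strict
  epigraph of a Lipschitz function on the hyperplane orthogonal to \<open>e\<close>; thus it lies locally on
  one side of its boundary.\<close>

definition lipschitz_boundary :: "(real^'n::finite) set \<Rightarrow> bool" where
  "lipschitz_boundary A \<longleftrightarrow>
     (\<forall>x\<in>frontier A. \<exists>r>0. \<exists>e \<gamma> C. norm e = 1 \<and> C-lipschitz_on {z. z \<bullet> e = 0} \<gamma> \<and>
        A \<inter> ball x r = {y \<in> ball x r. \<gamma> (y - (y \<bullet> e) *\<^sub>R e) < y \<bullet> e})"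

end

theory Submission
  imports Defs
begin

text \<open>Under this notion of Lipschitz boundary the set \<open>A = {u \<noteq> 0}\<close> lies locally on one side of its
  boundary, so \<open>u\<close> has a constant sign \<open>\<sigma>\<close> on \<open>A\<close> near each point \<open>p\<close> of \<open>\<Omega>\<close> on that boundary. Near
  such a \<open>p\<close>, replace \<open>\<sigma> u\<close> by a smoothed maximum of \<open>\<sigma> u\<close> and a paraboloid \<open>w\<close> with \<open>w p > 0\<close> and
  \<open>\<bar>\<nabla>w\<bar> \<le> \<parallel>\<nabla>u\<parallel>\<^sub>\<infinity>\<close>. The new gradient is pointwise a convex combination of \<open>\<nabla>u\<close> and \<open>\<sigma> \<nabla>w\<close>, so the functional
  does not increase, whereas the pairing with \<open>u\<close> does; this contradicts \<open>\<lambda> u \<in> \<partial>J(u)\<close>. Hence \<open>A\<close> is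
  relatively closed in the connected set \<open>\<Omega>\<close>, and the nodal set is even empty.

  The chain rule for the smoothed maximum needs no mollification: bounded weak partial derivatives
  make \<open>u\<close> Lipschitz along the axes, and difference quotients converge weakly against continuous
  functions, because these are uniform limits of polynomials times a bump.\<close>

section \<open>Smooth bump functions\<close>

text \<open>With \<open>z = w - \<sigma> * u\<close>, the competitor is \<open>\<sigma>\<close>
  times \<open>\<sigma> * u + c * (max 0 z)^2\<close>, cut off to a small ball. The plain maximum
  \<open>\<sigma> * u + max 0 z\<close> has a slope that jumps at \<open>z = 0\<close>, while the
  weak convergence of difference quotients can be tested only against continuous functions. Squaring
  makes the slope \<open>2 * c * max 0 z\<close> continuous and leaves a Taylor error of order
  \<open>t^2\<close>. The one-sided sign gives \<open>z \<le> \<delta>\<close>, so that the slope is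
  at most 1; it makes \<open>z \<le> 0\<close> near the cutoff; and it makes the gain in the pairing
  positive. Since the pairing of \<open>l * u\<close> with \<open>u\<close> equals
  \<open>J(u)\<close>, the subgradient inequality leaves no room for such a gain. Two definitions
  shape the preparation. \<open>weak_grad\<close> is a choice, so \<open>J_fun\<close> of the
  competitor can be read off an explicit gradient only after weak gradients are known to be unique
  almost everywhere. Test functions are smooth in the sense of iterated
  \<open>partial_deriv\<close>, so bumps are taken from a class of expressions closed under that
  operation.\<close>

lemma poly_over_exp_tendsto_0: "((\<lambda>s. s ^ k * poly q s / exp s) \<longlongrightarrow> (0::real)) at_top"
proof (induction q arbitrary: k)
  case 0
  then show ?case by simp
next
  case (pCons a q)
  have eq: "(\<lambda>s. s ^ k * poly (pCons a q) s / exp s) =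
      (\<lambda>s. a * (s ^ k / exp s) + s ^ Suc k * poly q s / exp s)"
    by (auto simp: algebra_simps add_divide_distrib)
  have "((\<lambda>s. a * (s ^ k / exp s) + s ^ Suc k * poly q s / exp s) \<longlongrightarrow> a * 0 + 0) at_top"
    by (intro tendsto_intros tendsto_power_div_exp_0 pCons.IH)
  then show ?case using eq by simp
qed

text \<open>\<open>flat 1\<close> is the classical \<open>exp (- 1 / t)\<close>, extended by
  \<open>0\<close>. The polynomial in \<open>1 / t\<close> is carried along because differentiation
  produces such factors; with it the family is closed under derivatives.\<close>

definition flat :: "real poly \<Rightarrow> real \<Rightarrow> real" where
  "flat p t = (if 0 < t then poly p (1 / t) * exp (- (1 / t)) else 0)"

lemma flat_0 [simp]: "flat p 0 = 0"
  by (simp add: flat_def)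

text \<open>With \<open>s = 1 / t\<close>, the product and chain rules give
  \<open>s^2 * (p s - p' s) * exp (- s)\<close>, and \<open>[:0, 0, 1:]\<close> is the polynomial
  \<open>s^2\<close>. The only delicate point is \<open>t = 0\<close>.\<close>

lemma DERIV_flat: "(flat p has_real_derivative flat ([:0, 0, 1:] * (p - pderiv p)) t) (at t)"
proof -
  consider "t > 0" | "t < 0" | "t = 0" by linarith
  then show ?thesis
  proof cases
    case 1
    have "((\<lambda>t. poly p (1 / t) * exp (- (1 / t))) has_real_derivative
        flat ([:0, 0, 1:] * (p - pderiv p)) t) (at t)"
      using 1 by (auto intro!: derivative_eq_intros DERIV_chain'[OF _ poly_DERIV]
          simp: flat_def field_simps power2_eq_square)
    then show ?thesis
      by (rule has_field_derivative_transform_within_open[where S = "{0<..}"])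
        (use 1 in \<open>auto simp: flat_def\<close>)
  next
    case 2
    have "((\<lambda>t. 0) has_real_derivative 0) (at t)" by simp
    then have "(flat p has_real_derivative 0) (at t)"
      by (rule has_field_derivative_transform_within_open[where S = "{..<0}"])
        (use 2 in \<open>auto simp: flat_def\<close>)
    then show ?thesis using 2 by (simp add: flat_def)
  next
    case 3
    \<comment> \<open>Substituting \<open>s = 1 / t\<close> turns the difference quotient at
      \<open>0\<close> into \<open>s * p s / exp s\<close>, where the exponential wins.\<close>
    have "((\<lambda>t. flat p t / t) \<longlongrightarrow> 0) (at_right 0)"
    proof -
      have "((\<lambda>s. s ^ 1 * poly p s / exp s) \<longlongrightarrow> (0::real)) at_top"
        by (rule poly_over_exp_tendsto_0)
      then have "((\<lambda>t. inverse t ^ 1 * poly p (inverse t) / exp (inverse t)) \<longlongrightarrow> (0::real)) (at_right 0)"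
        by (rule filterlim_compose[OF _ filterlim_inverse_at_top_right])
      moreover have "eventually (\<lambda>t::real. inverse t ^ 1 * poly p (inverse t) / exp (inverse t) = flat p t / t) (at_right 0)"
        by (auto simp: eventually_at_right_field flat_def field_simps exp_minus intro!: exI[of _ 1])
      ultimately show ?thesis by (blast intro: Lim_transform_eventually)
    qed
    moreover have "((\<lambda>t. flat p t / t) \<longlongrightarrow> 0) (at_left 0)"
      by (rule Lim_transform_eventually[OF tendsto_const])
        (auto simp: eventually_at_left_field flat_def intro!: exI[of _ "-1"])
    ultimately have "((\<lambda>t. flat p t / t) \<longlongrightarrow> 0) (at 0)"
      by (simp add: filterlim_at_split)
    then show ?thesis using 3 by (simp add: has_field_derivative_iff)
  qed
qed

section \<open>Smooth expressions and bumps\<close>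

inductive smooth_term :: "(real^'n::finite \<Rightarrow> real) \<Rightarrow> bool" where
  linear: "bounded_linear f \<Longrightarrow> smooth_term f"
| const: "smooth_term (\<lambda>x. c)"
| add: "smooth_term f \<Longrightarrow> smooth_term g \<Longrightarrow> smooth_term (\<lambda>x. f x + g x)"
| mult: "smooth_term f \<Longrightarrow> smooth_term g \<Longrightarrow> smooth_term (\<lambda>x. f x * g x)"
| flat: "smooth_term f \<Longrightarrow> smooth_term (\<lambda>x. flat p (f x))"

lemma smooth_term_polynomial: "real_polynomial_function f \<Longrightarrow> smooth_term f"
  by (induction rule: real_polynomial_function.induct) (auto intro: smooth_term.intros)

lemma smooth_term_sum: "(\<And>i. i \<in> I \<Longrightarrow> smooth_term (f i)) \<Longrightarrow> smooth_term (\<lambda>x. \<Sum>i\<in>I. f i x)"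
  by (induction I rule: infinite_finite_induct) (auto intro: smooth_term.intros)

lemma smooth_term_prod: "(\<And>i. i \<in> I \<Longrightarrow> smooth_term (f i)) \<Longrightarrow> smooth_term (\<lambda>x. \<Prod>i\<in>I. f i x)"
  by (induction I rule: infinite_finite_induct) (auto intro: smooth_term.intros)

lemma smooth_term_diff: "smooth_term f \<Longrightarrow> smooth_term g \<Longrightarrow> smooth_term (\<lambda>x. f x - g x)"
  using smooth_term.add[of f, OF _ smooth_term.mult[OF smooth_term.const[of "-1"], of g]] by simp

lemma smooth_term_component: "smooth_term (\<lambda>x. x $ i)"
  by (intro smooth_term.linear bounded_linear_vec_nth)

lemma partial_derivI:
  assumes "(f has_derivative f') (at x)"
  shows "partial_deriv i f x = f' (axis i 1)"
  using frechet_derivative_at[OF assms] by (simp add: partial_deriv_def)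

lemma smooth_term_partial_deriv:
  assumes "smooth_term f"
  shows "(\<forall>x. f differentiable (at x)) \<and> smooth_term (partial_deriv i f)"
  using assms
proof (induction rule: smooth_term.induct)
  case (linear f)
  have "partial_deriv i f = (\<lambda>x. f (axis i 1))"
    using bounded_linear_imp_has_derivative[OF linear] by (intro ext partial_derivI)
  with linear show ?case
    by (auto intro: smooth_term.intros bounded_linear_imp_differentiable)
next
  case (const c)
  have "partial_deriv i (\<lambda>x. c) = (\<lambda>x. 0)"
    by (intro ext partial_derivI) (auto intro!: derivative_eq_intros)
  then show ?case by (auto intro: smooth_term.intros)
next
  case (add f g)
  have "partial_deriv i (\<lambda>x. f x + g x) = (\<lambda>x. partial_deriv i f x + partial_deriv i g x)"
    using add by (auto intro!: ext partial_derivI[THEN trans] has_derivative_add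
        simp: frechet_derivative_works partial_deriv_def)
  with add show ?case by (auto intro: smooth_term.intros)
next
  case (mult f g)
  have "partial_deriv i (\<lambda>x. f x * g x) = (\<lambda>x. f x * partial_deriv i g x + partial_deriv i f x * g x)"
    using mult by (auto intro!: ext partial_derivI[THEN trans] has_derivative_mult
        simp: frechet_derivative_works partial_deriv_def)
  with mult show ?case by (auto intro: smooth_term.intros)
next
  case (flat f p)
  let ?q = "[:0, 0, 1:] * (p - pderiv p)"
  have der: "((\<lambda>x. flat p (f x)) has_derivative (\<lambda>h. flat ?q (f x) * frechet_derivative f (at x) h)) (at x)" for x
    using has_derivative_compose[OF flat.IH[THEN conjunct1, rule_format, THEN frechet_derivative_works[THEN iffD1]],
        OF DERIV_flat[THEN has_field_derivative_imp_has_derivative]] .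
  have "partial_deriv i (\<lambda>x. flat p (f x)) = (\<lambda>x. flat ?q (f x) * partial_deriv i f x)"
    by (intro ext partial_derivI[OF der, THEN trans]) (simp add: partial_deriv_def)
  moreover have "(\<lambda>x. flat p (f x)) differentiable (at x)" for x
    using der by (auto simp: differentiable_def)
  ultimately show ?case
    using flat smooth_term.mult[OF smooth_term.flat[of f ?q], of "partial_deriv i f"] by simp
qed

lemma smooth_term_C_k: "smooth_term f \<Longrightarrow> C_k k f"
proof (induction k arbitrary: f)
  case 0
  then show ?case
    by (auto intro!: differentiable_imp_continuous_on simp: differentiable_on_def
        dest: smooth_term_partial_deriv)
qed (auto dest: smooth_term_partial_deriv)

lemma smooth_term_test_function:
  assumes "smooth_term f" "compact K" "K \<subseteq> \<Omega>" "\<And>x. x \<notin> K \<Longrightarrow> f x = 0"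
  shows "f \<in> test_functions \<Omega>"
proof -
  have "closure {x. f x \<noteq> 0} \<subseteq> K"
    using assms by (intro closure_minimal compact_imp_closed) auto
  moreover from this have "compact (closure {x. f x \<noteq> 0})"
    by (metis assms(2) closed_closure compact_Int_closed inf.absorb2)
  ultimately show ?thesis
    using assms smooth_term_C_k by (auto simp: test_functions_def)
qed

text \<open>The unnormalised mollifier profile. The squared norm is a polynomial in the coordinates,
  so the bump is a \<open>smooth_term\<close>.\<close>

definition bump :: "real^'n::finite \<Rightarrow> real \<Rightarrow> real^'n \<Rightarrow> real" where
  "bump p r x = flat 1 (r\<^sup>2 - (norm (x - p))\<^sup>2)"

lemma smooth_term_norm_diff: "smooth_term (\<lambda>x. (norm (x - p))\<^sup>2)"
proof -
  have "(\<lambda>x. (norm (x - p))\<^sup>2) = (\<lambda>x. \<Sum>i\<in>UNIV. (x $ i - p $ i) * (x $ i - p $ i))"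
    by (auto simp: power2_norm_eq_inner inner_vec_def)
  then show ?thesis
    by (simp add: smooth_term_sum smooth_term.mult smooth_term_diff smooth_term_component smooth_term.const)
qed

lemma smooth_term_bump: "smooth_term (bump p r)"
  unfolding bump_def by (intro smooth_term.flat smooth_term_diff smooth_term.const smooth_term_norm_diff)

lemma bump_nonneg: "0 \<le> bump p r x"
  by (simp add: bump_def flat_def)

lemma bump_pos_iff: "r > 0 \<Longrightarrow> 0 < bump p r x \<longleftrightarrow> x \<in> ball p r"
  by (auto simp: bump_def flat_def dist_norm norm_minus_commute abs_square_less_1
      power_strict_mono dest: power2_less_imp_less)

lemma bump_eq_0: "r > 0 \<Longrightarrow> x \<notin> ball p r \<Longrightarrow> bump p r x = 0"
  using bump_pos_iff[of r p x] bump_nonneg[of p r x] by linarith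

lemma bump_translate: "bump p r (y - a) = bump (p + a) r y"
  by (simp add: bump_def algebra_simps)

section \<open>Uniqueness of weak gradients\<close>

lemma test_function_continuous: "\<psi> \<in> test_functions \<Omega> \<Longrightarrow> continuous_on UNIV \<psi>"
  unfolding test_functions_def by (auto dest: spec[of _ 0])

lemma test_function_differentiable: "\<psi> \<in> test_functions \<Omega> \<Longrightarrow> \<psi> differentiable (at x)"
  unfolding test_functions_def by (auto dest: spec[of _ 1])

lemma test_function_partial_continuous:
  "\<psi> \<in> test_functions \<Omega> \<Longrightarrow> continuous_on UNIV (partial_deriv i \<psi>)"
  unfolding test_functions_def by (auto dest: spec[of _ 1])

lemma partial_deriv_zero_open:
  assumes "open S" "x \<in> S" "\<And>y. y \<in> S \<Longrightarrow> f y = 0"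
  shows "partial_deriv i f x = 0"
proof -
  have "((\<lambda>y. 0) has_derivative (\<lambda>h. 0)) (at x)" by simp
  then have "(f has_derivative (\<lambda>h. 0)) (at x)"
    by (rule has_derivative_transform_within_open) (use assms in auto)
  then show ?thesis by (rule partial_derivI)
qed

lemma test_function_support:
  assumes "\<psi> \<in> test_functions \<Omega>"
  obtains K where "compact K" "K \<subseteq> \<Omega>" "\<And>x. x \<notin> K \<Longrightarrow> \<psi> x = 0"
    "\<And>x i. x \<notin> K \<Longrightarrow> partial_deriv i \<psi> x = 0"
proof
  let ?K = "closure {x. \<psi> x \<noteq> 0}"
  show "compact ?K" "?K \<subseteq> \<Omega>" using assms by (auto simp: test_functions_def)
  show *: "\<psi> x = 0" if "x \<notin> ?K" for x
    using that closure_subset[of "{x. \<psi> x \<noteq> 0}"] by blast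
  show "partial_deriv i \<psi> x = 0" if "x \<notin> ?K" for x i
  proof (rule partial_deriv_zero_open[of "- ?K"])
    show "open (- ?K)" by (simp add: open_closed)
    show "x \<in> - ?K" using that by simp
  qed (rule *, simp)
qed

lemma integrable_locally_mult:
  fixes f h :: "real^'n::finite \<Rightarrow> real"
  assumes "open \<Omega>" "locally_integrable \<Omega> f" "continuous_on UNIV h"
    and K: "compact K" "K \<subseteq> \<Omega>" "\<And>x. x \<notin> K \<Longrightarrow> h x = 0"
  shows "integrable (lebesgue_on \<Omega>) (\<lambda>x. f x * h x)"
proof -
  have h: "continuous_on K h" using assms(3) continuous_on_subset by blast
  have "(\<lambda>x. h x * f x) absolutely_integrable_on K"
  proof (rule absolutely_integrable_bounded_measurable_product[OF bilinear_times])
    show "h \<in> borel_measurable (lebesgue_on K)"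
      using h K(1) by (intro continuous_imp_measurable_on_sets_lebesgue) (auto simp: compact_imp_closed)
    show "bounded (h ` K)" using h K(1) compact_continuous_image compact_imp_bounded by blast
  qed (use assms(2) K in \<open>auto simp: locally_integrable_def compact_imp_closed\<close>)
  then have "integrable lebesgue (\<lambda>x. indicator K x *\<^sub>R (h x * f x))"
    by (simp add: set_integrable_def)
  also have "(\<lambda>x. indicator K x *\<^sub>R (h x * f x)) = (\<lambda>x. indicator \<Omega> x *\<^sub>R (f x * h x))"
    using K by (auto simp: indicator_def fun_eq_iff)
  finally show ?thesis
    using \<open>open \<Omega>\<close> by (subst integrable_restrict_space) auto
qed

lemma locally_integrable_component:
  assumes "locally_integrable \<Omega> (g :: real^'n::finite \<Rightarrow> real^'m::finite)"
  shows "locally_integrable \<Omega> (\<lambda>x. g x $ i)"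
  using assms absolutely_integrable_linear[OF _ bounded_linear_vec_nth[of i]]
  unfolding locally_integrable_def o_def by blast

section \<open>Boxes and the fundamental lemma of the calculus of variations\<close>

lemma flat_one_nonneg: "0 \<le> flat 1 t"
  by (simp add: flat_def)

lemma flat_one_le_one: "flat 1 t \<le> 1"
  by (simp add: flat_def)

text \<open>The functions \<open>flat 1 (n * t) = exp (- 1 / (n * t))\<close> increase to the indicator of \<open>t > 0\<close>.\<close>

lemma flat_one_scaled_tendsto:
  "(\<lambda>n. flat 1 (real (Suc n) * t)) \<longlonglongrightarrow> (if 0 < t then 1 else 0)"
proof (cases "0 < t")
  case True
  have "(\<lambda>n. exp (- (inverse (real (Suc n)) * (1 / t)))) \<longlonglongrightarrow> exp (- (0 * (1 / t)))"
    by (intro tendsto_intros LIMSEQ_inverse_real_of_nat)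
  moreover have "flat 1 (real (Suc n) * t) = exp (- (inverse (real (Suc n)) * (1 / t)))" for n
    using True by (simp add: flat_def inverse_eq_divide)
  ultimately show ?thesis using True by simp
next
  case False
  then have "\<not> 0 < real (Suc n) * t" for n by (simp add: zero_less_mult_iff)
  with False show ?thesis by (simp add: flat_def)
qed

text \<open>There is one \<open>flat\<close> factor per face: it vanishes on the face and beyond,
  and tends to 1 strictly inside. Hence the limit is the indicator of the open box, while the closed
  box serves as the compact set carrying the supports.\<close>

lemma box_indicator_limit_tests:
  fixes a b :: "real^'n::finite"
  assumes "cbox a b \<subseteq> \<Omega>"
  obtains \<psi> where "\<And>n. \<psi> n \<in> test_functions \<Omega>" "\<And>n x. \<bar>\<psi> n x\<bar> \<le> indicator (cbox a b) x"
    "\<And>x. (\<lambda>n. \<psi> n x) \<longlonglongrightarrow> indicator (box a b) x"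
proof
  define \<psi> :: "nat \<Rightarrow> real^'n \<Rightarrow> real" where "\<psi> n x =
    (\<Prod>i\<in>UNIV. flat 1 (real (Suc n) * (x $ i - a $ i)) * flat 1 (real (Suc n) * (b $ i - x $ i)))" for n x
  have zero: "\<psi> n x = 0" if "x \<notin> cbox a b" for n x
  proof -
    from that obtain i where "\<not> (a $ i \<le> x $ i \<and> x $ i \<le> b $ i)"
      by (auto simp: mem_box_cart)
    then have "\<exists>i. flat 1 (real (Suc n) * (x $ i - a $ i)) * flat 1 (real (Suc n) * (b $ i - x $ i)) = 0"
      by (intro exI[of _ i]) (auto simp: flat_def zero_less_mult_iff)
    then show ?thesis unfolding \<psi>_def by (subst prod_zero_iff) auto
  qed
  have st: "smooth_term (\<psi> n)" for n
    unfolding \<psi>_def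
    by (intro smooth_term_prod smooth_term.mult smooth_term.flat smooth_term_diff
        smooth_term.const smooth_term_component)
  show "\<psi> n \<in> test_functions \<Omega>" for n
    by (rule smooth_term_test_function[OF st compact_cbox assms zero])
  have "0 \<le> \<psi> n x" "\<psi> n x \<le> 1" for n x
    unfolding \<psi>_def
    by (auto intro!: prod_nonneg prod_le_1 mult_le_one mult_nonneg_nonneg flat_one_nonneg flat_one_le_one)
  then show "\<bar>\<psi> n x\<bar> \<le> indicator (cbox a b) x" for n x
    using zero[of x n] by (auto simp: indicator_def)
  show "(\<lambda>n. \<psi> n x) \<longlonglongrightarrow> indicator (box a b) x" for x
  proof -
    have "(\<lambda>n. \<psi> n x) \<longlonglongrightarrow> (\<Prod>i\<in>UNIV. (if 0 < x $ i - a $ i then 1 else 0) * (if 0 < b $ i - x $ i then 1 else 0))"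
      unfolding \<psi>_def by (intro tendsto_prod tendsto_mult flat_one_scaled_tendsto)
    also have "(\<Prod>i\<in>UNIV. (if 0 < x $ i - a $ i then 1 else 0) * (if 0 < b $ i - x $ i then 1 else 0)) = (indicator (box a b) x :: real)"
    proof (cases "x \<in> box a b")
      case False
      then obtain i where "\<not> (a $ i < x $ i \<and> x $ i < b $ i)" by (auto simp: mem_box_cart)
      then have "\<exists>i. (if 0 < x $ i - a $ i then 1 else 0) * (if 0 < b $ i - x $ i then 1 else (0::real)) = 0"
        by (intro exI[of _ i]) auto
      with False show ?thesis by (subst prod_zero_iff[THEN iffD2]) auto
    qed (auto simp: mem_box_cart)
    finally show ?thesis .
  qed
qed

text \<open>Open boxes form an intersection-stable generator of the Borel sets, and the sets over
  which \<open>f\<close> integrates to zero form a Dynkin system; the total integral is what closes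
  it under complements. A function whose integral over every measurable set is zero vanishes almost
  everywhere.\<close>

lemma AE_zero_of_zero_box_integrals:
  fixes f :: "real^'n::finite \<Rightarrow> real"
  assumes f: "integrable lebesgue f"
    and box: "\<And>a b. (LINT x|lebesgue. indicator (box a b) x *\<^sub>R f x) = 0"
    and tot: "integral\<^sup>L lebesgue f = 0"
  shows "AE x in lebesgue. f x = 0"
proof -
  have borel: "set_lebesgue_integral lebesgue A f = 0"
    if "A \<in> sigma_sets UNIV (range (\<lambda>(a, b). box a b :: (real^'n) set))" for A
  proof -
    have "Int_stable (range (\<lambda>(a, b). box a b :: (real^'n) set))"
      by (auto simp: Int_stable_def box_Int_box)
    then show ?thesis using subset_UNIV[of "range (\<lambda>(a, b). box a b :: (real^'n) set)", folded Pow_UNIV] that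
  proof (induction rule: sigma_sets_induct_disjoint)
    case (basic A)
    then show ?case using box by (auto simp: set_lebesgue_integral_def)
  next
    case empty
    then show ?case by (simp add: set_lebesgue_integral_def)
  next
    case (compl A)
    then have A: "A \<in> sets lebesgue"
      using sets_completionI_sets[of A lborel] by (simp add: borel_eq_box)
    then have "integrable lebesgue (\<lambda>x. indicator A x *\<^sub>R f x)"
      using f by (rule integrable_mult_indicator)
    then have "(LINT x|lebesgue. f x - indicator A x *\<^sub>R f x) =
        integral\<^sup>L lebesgue f - set_lebesgue_integral lebesgue A f"
      using f by (simp add: set_lebesgue_integral_def)
    moreover have "(\<lambda>x. f x - indicator A x *\<^sub>R f x) = (\<lambda>x. indicator (UNIV - A) x *\<^sub>R f x)"
      by (auto simp: indicator_def fun_eq_iff)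
    ultimately have "set_lebesgue_integral lebesgue (UNIV - A) f =
        integral\<^sup>L lebesgue f - set_lebesgue_integral lebesgue A f"
      by (simp add: set_lebesgue_integral_def)
    with compl tot show ?case by simp
  next
    case (union A)
    have A: "A i \<in> sets lebesgue" for i
      using rangeI[of A i, THEN subsetD[OF union(2)]] sets_completionI_sets[of "A i" lborel]
      by (simp add: borel_eq_box)
    moreover have "set_integrable lebesgue (\<Union>i. A i) f"
      using A f unfolding set_integrable_def by (intro integrable_mult_indicator) auto
    ultimately have "set_lebesgue_integral lebesgue (\<Union>i. A i) f = (\<Sum>i. set_lebesgue_integral lebesgue (A i) f)"
      using union(1) by (intro lebesgue_integral_countable_add) (auto simp: disjoint_family_on_def)
    then show ?case using union(3) by simp
  qed
  qed
  show ?thesis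
  proof (rule density_unique_real[OF f integrable_zero])
    fix A :: "(real^'n) set" assume "A \<in> sets lebesgue"
    \<comment> \<open>A Lebesgue set is a Borel set up to a subset of a Borel null set, so the Borel
      case suffices.\<close>
    then obtain S N N' where A: "A = S \<union> N" "N \<subseteq> N'" "N' \<in> null_sets lborel" "S \<in> sets lborel"
      by (rule sets_completionE)
    have S: "S \<in> sets lebesgue" using A by auto
    have "AE x in lebesgue. x \<notin> N'"
      using A(3) by (intro AE_not_in null_sets_completionI)
    then have "set_lebesgue_integral lebesgue A f = set_lebesgue_integral lebesgue S f"
      unfolding set_lebesgue_integral_def
    proof (intro integral_cong_AE)
      show "AE x in lebesgue. indicator A x *\<^sub>R f x = indicator S x *\<^sub>R f x"
        using \<open>AE x in lebesgue. x \<notin> N'\<close> by eventually_elim (use A(1,2) in \<open>auto simp: indicator_def\<close>)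
    qed (intro borel_measurable_scaleR borel_measurable_indicator borel_measurable_integrable f S
        \<open>A \<in> sets lebesgue\<close>)+
    also have "\<dots> = 0" using A(4) by (intro borel) (simp add: borel_eq_box)
    finally show "set_lebesgue_integral lebesgue A f = set_lebesgue_integral lebesgue A (\<lambda>x. 0)"
      by (simp add: set_lebesgue_integral_def)
  qed
qed

text \<open>Test functions approximating a box turn the hypothesis into vanishing box integrals, by
  dominated convergence with majorant \<open>\<bar>d\<bar>\<close> on the closed box. As
  \<open>d\<close> is only locally integrable, the conclusion is first drawn on boxes whose closure
  lies in \<open>\<Omega>\<close>.\<close>

lemma fundamental_lemma_calculus_of_variations:
  fixes d :: "real^'n::finite \<Rightarrow> real"
  assumes "open \<Omega>" and d: "locally_integrable \<Omega> d"
    and zero: "\<And>\<psi>. \<psi> \<in> test_functions \<Omega> \<Longrightarrow> (LINT x|lebesgue_on \<Omega>. d x * \<psi> x) = 0"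
  shows "AE x in lebesgue_on \<Omega>. d x = 0"
proof -
  have box0: "(LINT x|lebesgue. indicator (box a b) x *\<^sub>R d x) = 0" if ab: "cbox a b \<subseteq> \<Omega>" for a b
  proof -
    obtain \<psi> where \<psi>: "\<And>n. \<psi> n \<in> test_functions \<Omega>"
      "\<And>n x. \<bar>\<psi> n x\<bar> \<le> indicator (cbox a b) x" "\<And>x. (\<lambda>n. \<psi> n x) \<longlonglongrightarrow> indicator (box a b) x"
      using box_indicator_limit_tests[OF ab] by metis
    have di: "integrable lebesgue (\<lambda>x. indicator (cbox a b) x *\<^sub>R d x)"
      using d ab by (auto simp: locally_integrable_def set_integrable_def)
    have \<psi>0: "\<psi> n x = 0" if "x \<notin> cbox a b" for n x using \<psi>(2)[of n x] that by simp
    have [measurable]: "(\<lambda>x. indicator (cbox a b) x *\<^sub>R d x) \<in> borel_measurable lebesgue"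
      using di by auto
    have [measurable]: "\<psi> n \<in> borel_measurable lebesgue" for n
      by (rule measurable_completion)
        (use test_function_continuous[OF \<psi>(1)] in \<open>simp add: borel_measurable_continuous_onI\<close>)
    have eq: "(\<lambda>x. \<psi> n x *\<^sub>R (indicator (cbox a b) x *\<^sub>R d x)) = (\<lambda>x. indicator \<Omega> x *\<^sub>R (d x * \<psi> n x))" for n
      using \<psi>0 ab by (fastforce simp: indicator_def fun_eq_iff)
    have "(\<lambda>n. LINT x|lebesgue. \<psi> n x *\<^sub>R (indicator (cbox a b) x *\<^sub>R d x)) \<longlonglongrightarrow>
        (LINT x|lebesgue. indicator (box a b) x *\<^sub>R (indicator (cbox a b) x *\<^sub>R d x))"
    proof (rule integral_dominated_convergence[where w="\<lambda>x. \<bar>indicator (cbox a b) x *\<^sub>R d x\<bar>"])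
      show "AE x in lebesgue. norm (\<psi> n x *\<^sub>R (indicator (cbox a b) x *\<^sub>R d x)) \<le> \<bar>indicator (cbox a b) x *\<^sub>R d x\<bar>" for n
      proof (rule AE_I2)
        fix x
        have "\<bar>\<psi> n x\<bar> \<le> 1" using order_trans[OF \<psi>(2) indicator_le_1] .
        then have "\<bar>\<psi> n x\<bar> * \<bar>indicator (cbox a b) x *\<^sub>R d x\<bar> \<le> \<bar>indicator (cbox a b) x *\<^sub>R d x\<bar>"
          by (intro mult_left_le_one_le) auto
        then show "norm (\<psi> n x *\<^sub>R (indicator (cbox a b) x *\<^sub>R d x)) \<le> \<bar>indicator (cbox a b) x *\<^sub>R d x\<bar>"
          by (simp add: abs_mult)
      qed
      show "AE x in lebesgue. (\<lambda>n. \<psi> n x *\<^sub>R (indicator (cbox a b) x *\<^sub>R d x)) \<longlonglongrightarrow>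
          indicator (box a b) x *\<^sub>R (indicator (cbox a b) x *\<^sub>R d x)"
        using \<psi>(3) by (auto intro!: AE_I2 tendsto_intros)
      show "(\<lambda>x. indicator (box a b) x *\<^sub>R (indicator (cbox a b) x *\<^sub>R d x)) \<in> borel_measurable lebesgue"
        by (intro borel_measurable_scaleR[OF borel_measurable_indicator borel_measurable_integrable[OF di]]) auto
    qed (use di in auto)
    moreover have "(LINT x|lebesgue. \<psi> n x *\<^sub>R (indicator (cbox a b) x *\<^sub>R d x)) = 0" for n
      unfolding eq using integral_restrict_space[of \<Omega> lebesgue "\<lambda>x. d x * \<psi> n x"] zero[OF \<psi>(1)] \<open>open \<Omega>\<close> by simp
    ultimately have "(LINT x|lebesgue. indicator (box a b) x *\<^sub>R (indicator (cbox a b) x *\<^sub>R d x)) = 0"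
      by (simp add: LIMSEQ_const_iff)
    moreover have "(\<lambda>x. indicator (box a b) x *\<^sub>R (indicator (cbox a b) x *\<^sub>R d x)) = (\<lambda>x. indicator (box a b) x *\<^sub>R d x)"
      using box_subset_cbox[of a b] by (auto simp: indicator_def fun_eq_iff)
    ultimately show ?thesis by simp
  qed
  have local: "AE x in lebesgue. x \<in> box p q \<longrightarrow> d x = 0" if pq: "cbox p q \<subseteq> \<Omega>" for p q
  proof -
    let ?f = "\<lambda>x. indicator (box p q) x *\<^sub>R d x"
    have "AE x in lebesgue. ?f x = 0"
    proof (rule AE_zero_of_zero_box_integrals)
      have "set_integrable lebesgue (cbox p q) d"
        using d pq by (auto simp: locally_integrable_def)
      then have "set_integrable lebesgue (box p q) d"
        by (rule set_integrable_subset) (auto simp: box_subset_cbox)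
      then show "integrable lebesgue ?f" by (simp add: set_integrable_def)
      show "integral\<^sup>L lebesgue ?f = 0" by (rule box0[OF pq])
      show "(LINT x|lebesgue. indicator (box a b) x *\<^sub>R ?f x) = 0" for a b
      proof -
        have eq: "(\<lambda>x. indicator (box a b) x *\<^sub>R ?f x) = (\<lambda>x. indicator (box a b \<inter> box p q) x *\<^sub>R d x)"
          by (auto simp: indicator_def fun_eq_iff)
        obtain a' b' where ab': "box a b \<inter> box p q = box a' b'" by (auto simp: box_Int_box)
        show ?thesis
        \<comment> \<open>Only a nonempty open box has the closed box as its closure; for an empty
          one, \<open>cbox a' b'\<close> could stick out of \<open>\<Omega>\<close>, but then the
          integral is trivially zero.\<close>
        proof (cases "box a' b' = {}")
          case False
          then have "cbox a' b' = closure (box a' b')" by simp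
          also have "\<dots> \<subseteq> closure (box p q)" using ab' by (intro closure_mono) auto
          also have "\<dots> \<subseteq> cbox p q" by (intro closure_minimal) (auto simp: box_subset_cbox)
          finally show ?thesis using pq unfolding eq ab' by (intro box0) auto
        qed (simp only: eq ab', simp)
      qed
    qed
    then show ?thesis by eventually_elim (auto simp: indicator_def split: if_splits)
  qed
  \<comment> \<open>A null set is obtained for each box, so a countable subcover is needed before
    they can be united.\<close>
  let ?F = "{B. \<exists>p q. B = box p q \<and> cbox p q \<subseteq> \<Omega>}"
  obtain F' where F': "F' \<subseteq> ?F" "countable F'" "\<Union>F' = \<Union>?F"
  proof (rule Lindelof)
    show "open B" if "B \<in> ?F" for B using that by (auto simp: open_box)
  qed
  have cov: "\<Omega> \<subseteq> \<Union>F'"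
  proof
    fix x assume "x \<in> \<Omega>"
    then obtain a b where "cbox a b \<subseteq> \<Omega>" "x \<in> box a b"
      using open_contains_cbox[OF \<open>open \<Omega>\<close>] by metis
    then show "x \<in> \<Union>F'" unfolding F'(3) by blast
  qed
  have "AE x in lebesgue. x \<in> B \<longrightarrow> d x = 0" if "B \<in> F'" for B
    using that F'(1) local by blast
  then have "AE x in lebesgue. \<forall>B\<in>F'. x \<in> B \<longrightarrow> d x = 0"
    by (subst AE_ball_countable[OF F'(2)]) blast
  then have "AE x in lebesgue. x \<in> \<Omega> \<longrightarrow> d x = 0"
    by eventually_elim (use cov in auto)
  then show ?thesis using \<open>open \<Omega>\<close> by (subst AE_restrict_space_iff) auto
qed

lemma is_weak_grad_unique:
  assumes "open \<Omega>" "is_weak_grad \<Omega> u g" "is_weak_grad \<Omega> u h"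
  shows "AE x in lebesgue_on \<Omega>. g x = h x"
proof -
  have "AE x in lebesgue_on \<Omega>. g x $ i - h x $ i = 0" for i
  proof (rule fundamental_lemma_calculus_of_variations[OF \<open>open \<Omega>\<close>])
    have gh: "locally_integrable \<Omega> (\<lambda>x. g x $ i)" "locally_integrable \<Omega> (\<lambda>x. h x $ i)"
      using assms by (auto simp: is_weak_grad_def intro: locally_integrable_component)
    then show "locally_integrable \<Omega> (\<lambda>x. g x $ i - h x $ i)"
      unfolding locally_integrable_def by (metis set_integral_diff(1))
    fix \<psi> assume \<psi>: "\<psi> \<in> test_functions \<Omega>"
    obtain K where K: "compact K" "K \<subseteq> \<Omega>" "\<And>x. x \<notin> K \<Longrightarrow> \<psi> x = 0"
      using test_function_support[OF \<psi>] by metis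
    note int = integrable_locally_mult[OF \<open>open \<Omega>\<close> _ test_function_continuous[OF \<psi>] K]
    have "(LINT x|lebesgue_on \<Omega>. g x $ i * \<psi> x) = (LINT x|lebesgue_on \<Omega>. h x $ i * \<psi> x)"
      using assms(2,3)[unfolded is_weak_grad_def, THEN conjunct2, THEN conjunct2, rule_format, OF \<psi>, of i]
      by linarith
    moreover have "integrable (lebesgue_on \<Omega>) (\<lambda>x. g x $ i * \<psi> x)" by (rule int[OF gh(1)])
    moreover have "integrable (lebesgue_on \<Omega>) (\<lambda>x. h x $ i * \<psi> x)" by (rule int[OF gh(2)])
    ultimately show "(LINT x|lebesgue_on \<Omega>. (g x $ i - h x $ i) * \<psi> x) = 0"
      by (simp add: left_diff_distrib)
  qed
  then have "AE x in lebesgue_on \<Omega>. \<forall>i\<in>UNIV. g x $ i - h x $ i = 0"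
    by (intro AE_finite_allI) auto
  then show ?thesis by eventually_elim (auto simp: vec_eq_iff)
qed

text \<open>Makes \<open>J_fun\<close> computable: the arbitrary choice in \<open>weak_grad\<close>
  may be replaced by any explicit essentially bounded weak gradient.\<close>

lemma Linf_norm_weak_grad:
  assumes "open \<Omega>" "is_weak_grad \<Omega> u g" "g \<in> Linf \<Omega>"
  shows "Linf_norm \<Omega> (weak_grad \<Omega> u) = Linf_norm \<Omega> g"
proof -
  have "is_weak_grad \<Omega> u (weak_grad \<Omega> u)"
    unfolding weak_grad_def by (rule someI[of "is_weak_grad \<Omega> u", OF assms(2)])
  then have ae: "AE x in lebesgue_on \<Omega>. g x = weak_grad \<Omega> u x"
    by (rule is_weak_grad_unique[OF assms(1,2)])
  have g: "g \<in> borel_measurable (lebesgue_on \<Omega>)" using assms(3) by (simp add: Linf_def)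
  have \<Omega>: "\<Omega> \<in> sets lebesgue" using \<open>open \<Omega>\<close> by auto
  have "AE x in lebesgue. (if x \<in> \<Omega> then g x else 0) = (if x \<in> \<Omega> then weak_grad \<Omega> u x else 0)"
    using ae \<Omega> by (subst (asm) AE_restrict_space_iff) auto
  \<comment> \<open>Measurability of the chosen representative is inherited from \<open>g\<close>
    through the almost everywhere equality, because Lebesgue measure is complete.\<close>
  then have "weak_grad \<Omega> u \<in> borel_measurable (lebesgue_on \<Omega>)"
    by (rule borel_measurable_if_D[OF borel_measurable_AE[OF borel_measurable_if_I[OF g \<Omega>]]])
  with g ae show ?thesis
    unfolding Linf_norm_def by (intro esssup_AE_cong) auto
qed

section \<open>Difference quotients and approximation\<close>

lemma continuous_compact_integrable:
  fixes f :: "'a::euclidean_space \<Rightarrow> real"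
  assumes "continuous_on UNIV f" "compact K" "\<And>x. x \<notin> K \<Longrightarrow> f x = 0"
  shows "integrable lborel f" "integrable lebesgue f"
proof -
  have "integrable lborel (\<lambda>x. indicator K x *\<^sub>R f x)"
    using assms continuous_on_subset by (intro borel_integrable_compact) blast+
  also have "(\<lambda>x. indicator K x *\<^sub>R f x) = f"
    using assms(3) by (auto simp: indicator_def fun_eq_iff)
  finally show *: "integrable lborel f" .
  then show "integrable lebesgue f" by (subst integrable_completion) auto
qed

lemma continuous_integral_cbox:
  fixes f :: "'a::euclidean_space \<Rightarrow> real"
  assumes "continuous_on UNIV f" "\<And>x. x \<notin> cbox a b \<Longrightarrow> f x = 0"
  shows "integral\<^sup>L lebesgue f = integral (cbox a b) f"
proof -
  have f: "integrable lborel f"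
    using continuous_compact_integrable(1)[OF assms(1) compact_cbox assms(2)] .
  then have "integral\<^sup>L lebesgue f = integral\<^sup>L lborel f" by (intro integral_completion) auto
  also have "\<dots> = integral UNIV f" using integral_lborel[OF f] by simp
  also have "(\<lambda>x. if x \<in> cbox a b then f x else 0) = f" using assms(2) by auto
  then have "integral UNIV f = integral (cbox a b) f"
    using integral_restrict_UNIV[of "cbox a b" f] by simp
  finally show ?thesis .
qed

lemma continuous_integral_pos:
  fixes f :: "'a::euclidean_space \<Rightarrow> real"
  assumes f: "continuous_on UNIV f" "\<And>x. 0 \<le> f x" "0 < f p" and K: "compact K" "\<And>x. x \<notin> K \<Longrightarrow> f x = 0"
  shows "0 < integral\<^sup>L lebesgue f"
proof -
  obtain a where a: "K \<union> {p} \<subseteq> box (-a) a"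
    using bounded_subset_box_symmetric[of "K \<union> {p}"] compact_imp_bounded[OF K(1)] by auto
  have c: "continuous_on (cbox (-a) a) f" using f(1) continuous_on_subset by blast
  have eq: "integral\<^sup>L lebesgue f = integral (cbox (-a) a) f"
    using a box_subset_cbox[of "-a" a] K(2) by (intro continuous_integral_cbox[OF f(1)]) blast
  have "integral (cbox (-a) a) f \<noteq> 0"
  proof
    assume "integral (cbox (-a) a) f = 0"
    then have "\<forall>x\<in>cbox (-a) a. f x = 0"
      using integral_cbox_eq_0_iff[OF c] a f(2) by auto
    then show False using a box_subset_cbox[of "-a" a] f(3) by auto
  qed
  moreover have "0 \<le> integral (cbox (-a) a) f" by (intro integral_nonneg integrable_continuous c f(2))
  ultimately show ?thesis using eq by simp
qed

lemma continuous_integral_translate: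
  fixes f :: "'a::euclidean_space \<Rightarrow> real"
  assumes "continuous_on UNIV f"
  shows "(LINT x|lebesgue. f (x + a)) = integral\<^sup>L lebesgue f"
proof -
  have [measurable]: "f \<in> borel_measurable borel" by (rule borel_measurable_continuous_onI[OF assms])
  have "(LINT x|lebesgue. f (x + a)) = (LINT x|lborel. f (x + a))" by (rule integral_completion) measurable
  also have "\<dots> = (LINT x|distr lborel borel ((+) a). f x)"
    by (subst integral_distr) (auto simp: add.commute)
  also have "\<dots> = integral\<^sup>L lebesgue f" by (simp add: lborel_distr_plus integral_completion)
  finally show ?thesis .
qed

lemma integral_abs_bound_on_set:
  fixes f :: "'a::euclidean_space \<Rightarrow> real"
  assumes "S \<in> lmeasurable" "AE x in lebesgue. \<bar>f x\<bar> \<le> c * indicator S x" "0 \<le> c"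
  shows "\<bar>integral\<^sup>L lebesgue f\<bar> \<le> c * measure lebesgue S"
proof (cases "integrable lebesgue f")
  case True
  have i: "integrable lebesgue (\<lambda>x. c * indicator S x)"
    using assms(1) by (intro integrable_mult_right integrable_real_indicator) (auto simp: fmeasurable_def)
  have "\<bar>integral\<^sup>L lebesgue f\<bar> \<le> (LINT x|lebesgue. \<bar>f x\<bar>)"
    using integral_norm_bound[of lebesgue f] by simp
  also have "\<dots> \<le> (LINT x|lebesgue. c * indicator S x)"
    using True assms(2) i by (intro integral_mono_AE) auto
  finally show ?thesis by simp
next
  \<comment> \<open>A non-integrable function has the default integral \<open>0\<close>, and the
    bound is then just nonnegativity of the right-hand side.\<close>
  case False
  then show ?thesis using assms(3) by (simp add: not_integrable_integral_eq)
qed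

lemma integrable_bounded_mult_continuous:
  fixes Z h :: "'a::euclidean_space \<Rightarrow> real"
  assumes Z: "Z \<in> borel_measurable lebesgue" "AE x in lebesgue. \<bar>Z x\<bar> \<le> C"
    and h: "continuous_on UNIV h" "compact K" "\<And>x. x \<notin> K \<Longrightarrow> h x = 0"
  shows "integrable lebesgue (\<lambda>x. Z x * h x)"
proof (rule Bochner_Integration.integrable_bound)
  have hi: "integrable lebesgue h" by (rule continuous_compact_integrable[OF h])
  then show "integrable lebesgue (\<lambda>x. C * h x)" by simp
  show "(\<lambda>x. Z x * h x) \<in> borel_measurable lebesgue"
    using Z(1) hi by (intro borel_measurable_times) auto
  show "AE x in lebesgue. norm (Z x * h x) \<le> norm (C * h x)"
    using Z(2) by eventually_elim (auto simp: abs_mult intro!: mult_right_mono)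
qed

lemma partial_deriv_translate:
  assumes "f differentiable (at (x - a))"
  shows "partial_deriv i (\<lambda>y. f (y - a)) x = partial_deriv i f (x - a)"
proof -
  have "((\<lambda>y. f (y - a)) has_derivative frechet_derivative f (at (x - a))) (at x)"
    using assms by (intro has_derivative_compose[where g=f and f="\<lambda>y. y - a" and f'="\<lambda>h. h"])
      (auto intro!: derivative_eq_intros simp: frechet_derivative_works)
  then show ?thesis by (auto dest: partial_derivI simp: partial_deriv_def)
qed

lemma DERIV_along_axis:
  assumes "f differentiable (at (x - s *\<^sub>R axis i 1))"
  shows "((\<lambda>s. f (x - s *\<^sub>R axis i 1)) has_real_derivative - partial_deriv i f (x - s *\<^sub>R axis i 1)) (at s)"
proof -
  let ?f' = "frechet_derivative f (at (x - s *\<^sub>R axis i 1))"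
  have d: "(f has_derivative ?f') (at (x - s *\<^sub>R axis i 1))"
    using assms by (simp add: frechet_derivative_works)
  have l: "linear ?f'" using d by (rule has_derivative_linear)
  have "((\<lambda>s. f (x - s *\<^sub>R axis i 1)) has_derivative (\<lambda>h. ?f' (- (h *\<^sub>R axis i 1)))) (at s)"
    using d by (intro has_derivative_compose[where g=f and f="\<lambda>s. x - s *\<^sub>R axis i 1" and g'="?f'"])
      (auto intro!: derivative_eq_intros)
  then show ?thesis
    unfolding has_field_derivative_def
    by (rule has_derivative_eq_rhs)
      (auto simp: linear_neg[OF l] linear_scale[OF l] partial_deriv_def fun_eq_iff)
qed

text \<open>The shift acts on the smooth factor \<open>\<psi>\<close>, so differentiation under the
  integral asks no more of \<open>z\<close> than continuity.\<close>

lemma DERIV_integral_shift: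
  fixes z :: "real^'n::finite \<Rightarrow> real"
  assumes z: "continuous_on UNIV z" and \<psi>: "\<psi> \<in> test_functions \<Omega>"
  shows "((\<lambda>s. LINT y|lebesgue. z y * \<psi> (y - s *\<^sub>R axis i 1)) has_real_derivative
      - (LINT y|lebesgue. z y * partial_deriv i \<psi> (y - s0 *\<^sub>R axis i 1))) (at s0)"
proof -
  obtain K where K: "compact K" "\<And>x. x \<notin> K \<Longrightarrow> \<psi> x = 0" "\<And>x. x \<notin> K \<Longrightarrow> partial_deriv i \<psi> x = 0"
    using test_function_support[OF \<psi>] by metis
  obtain R where R: "\<And>x. x \<in> K \<Longrightarrow> norm x \<le> R"
    using compact_imp_bounded[OF K(1)] by (auto simp: bounded_iff)
  \<comment> \<open>One box that contains the shifted supports for all \<open>s\<close> within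
    distance 1 of \<open>s0\<close>; Leibniz's rule needs a domain independent of
    \<open>s\<close>.\<close>
  obtain a where a: "cball (0::real^'n) (R + \<bar>s0\<bar> + 1) \<subseteq> cbox (-a) a"
    using bounded_subset_cbox_symmetric[OF bounded_cball] by metis
  let ?U = "ball s0 1"
  have out: "y - s *\<^sub>R axis i 1 \<notin> K" if "s \<in> ?U" "y \<notin> cbox (-a) a" for s y
  proof
    assume "y - s *\<^sub>R axis i 1 \<in> K"
    then have "norm (y - s *\<^sub>R axis i 1) \<le> R" by (rule R)
    moreover have "norm y \<le> norm (y - s *\<^sub>R axis i 1) + norm (s *\<^sub>R (axis i 1 :: real^'n))"
      using norm_triangle_ineq[of "y - s *\<^sub>R axis i 1" "s *\<^sub>R axis i 1"] by simp
    moreover have "norm (s *\<^sub>R (axis i 1 :: real^'n)) \<le> \<bar>s0\<bar> + 1"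
      using that(1) by (simp add: dist_real_def norm_axis_1)
    ultimately have "y \<in> cball 0 (R + \<bar>s0\<bar> + 1)" by simp
    with a that(2) show False by blast
  qed
  have c\<psi>: "continuous_on UNIV (\<lambda>y. \<psi> (y - s *\<^sub>R axis i 1))"
    "continuous_on UNIV (\<lambda>y. partial_deriv i \<psi> (y - s *\<^sub>R axis i 1))" for s
    by (rule continuous_on_compose2[OF test_function_continuous[OF \<psi>]]
        continuous_on_compose2[OF test_function_partial_continuous[OF \<psi>]]; auto intro!: continuous_intros)+
  have I1: "(LINT y|lebesgue. z y * \<psi> (y - s *\<^sub>R axis i 1)) =
      integral (cbox (-a) a) (\<lambda>y. z y * \<psi> (y - s *\<^sub>R axis i 1))" if "s \<in> ?U" for s
    using out[OF that] K(2) by (intro continuous_integral_cbox continuous_on_mult z c\<psi>) auto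
  have I2: "(LINT y|lebesgue. z y * - partial_deriv i \<psi> (y - s0 *\<^sub>R axis i 1)) =
      integral (cbox (-a) a) (\<lambda>y. z y * - partial_deriv i \<psi> (y - s0 *\<^sub>R axis i 1))"
    using out[of s0] K(3) by (intro continuous_integral_cbox continuous_on_mult z c\<psi> continuous_on_minus) auto
  have "((\<lambda>s. integral (cbox (-a) a) (\<lambda>y. z y * \<psi> (y - s *\<^sub>R axis i 1))) has_field_derivative
      integral (cbox (-a) a) (\<lambda>y. z y * - partial_deriv i \<psi> (y - s0 *\<^sub>R axis i 1))) (at s0 within ?U)"
  proof (rule leibniz_rule_field_derivative)
    fix s y assume "s \<in> ?U" "y \<in> cbox (-a) a"
    show "((\<lambda>s. z y * \<psi> (y - s *\<^sub>R axis i 1)) has_field_derivative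
        z y * - partial_deriv i \<psi> (y - s *\<^sub>R axis i 1)) (at s within ?U)"
      by (intro DERIV_cmult has_field_derivative_at_within[OF DERIV_along_axis]
          test_function_differentiable[OF \<psi>])
  next
    fix s
    have "continuous_on UNIV (\<lambda>y. z y * \<psi> (y - s *\<^sub>R axis i 1))"
      by (intro continuous_on_mult z c\<psi>)
    then show "(\<lambda>y. z y * \<psi> (y - s *\<^sub>R axis i 1)) integrable_on cbox (-a) a"
      by (intro integrable_continuous) (blast intro: continuous_on_subset)
  next
    have "continuous_on (?U \<times> cbox (-a) a) (\<lambda>w. z (snd w) * - partial_deriv i \<psi> (snd w - fst w *\<^sub>R axis i 1))"
      by (intro continuous_on_mult continuous_on_minus continuous_on_compose2[OF z]
          continuous_on_compose2[OF test_function_partial_continuous[OF \<psi>]] continuous_intros) auto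
    then show "continuous_on (?U \<times> cbox (-a) a) (\<lambda>(s, y). z y * - partial_deriv i \<psi> (y - s *\<^sub>R axis i 1))"
      by (simp add: case_prod_beta)
  qed auto
  then have "((\<lambda>s. integral (cbox (-a) a) (\<lambda>y. z y * \<psi> (y - s *\<^sub>R axis i 1))) has_real_derivative
      (LINT y|lebesgue. z y * - partial_deriv i \<psi> (y - s0 *\<^sub>R axis i 1))) (at s0)"
    unfolding I2 by (simp add: at_within_open[of s0 ?U])
  then have "((\<lambda>s. LINT y|lebesgue. z y * \<psi> (y - s *\<^sub>R axis i 1)) has_real_derivative
      (LINT y|lebesgue. z y * - partial_deriv i \<psi> (y - s0 *\<^sub>R axis i 1))) (at s0)"
    by (rule has_field_derivative_transform_within_open[of _ _ _ ?U]) (auto simp: I1)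
  then show ?thesis by simp
qed

text \<open>Discrete integration by parts: translation invariance moves the shift from
  \<open>z\<close> to \<open>\<psi>\<close>, so the integral is the difference quotient at
  \<open>0\<close> of a function whose derivative is already known.\<close>

lemma difference_quotient_integral_tendsto:
  fixes z :: "real^'n::finite \<Rightarrow> real"
  assumes z: "continuous_on UNIV z" and \<psi>: "\<psi> \<in> test_functions \<Omega>"
  shows "((\<lambda>t. LINT x|lebesgue. \<psi> x * ((z (x + t *\<^sub>R axis i 1) - z x) / t)) \<longlongrightarrow>
      - (LINT x|lebesgue. z x * partial_deriv i \<psi> x)) (at 0)"
proof -
  obtain K where K: "compact K" "\<And>x. x \<notin> K \<Longrightarrow> \<psi> x = 0"
    using test_function_support[OF \<psi>] by metis
  define \<theta> where "\<theta> s = (LINT y|lebesgue. z y * \<psi> (y - s *\<^sub>R axis i 1))" for s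
  have zt: "continuous_on UNIV (\<lambda>x. z (x + t *\<^sub>R axis i 1))" for t
    by (rule continuous_on_compose2[OF z]) (auto intro!: continuous_intros)
  have \<theta>t: "\<theta> t = (LINT x|lebesgue. z (x + t *\<^sub>R axis i 1) * \<psi> x)" for t
    using continuous_integral_translate[of "\<lambda>y. z y * \<psi> (y - t *\<^sub>R axis i 1)" "t *\<^sub>R axis i 1"] unfolding \<theta>_def
    by (simp add: z continuous_on_mult continuous_on_compose2[OF test_function_continuous[OF \<psi>]] continuous_intros)
  have eq: "(LINT x|lebesgue. \<psi> x * ((z (x + t *\<^sub>R axis i 1) - z x) / t)) = (\<theta> (0 + t) - \<theta> 0) / t" for t
  proof -
    have i: "integrable lebesgue (\<lambda>x. z (x + t *\<^sub>R axis i 1) * \<psi> x)" for t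
      by (rule continuous_compact_integrable(2)[OF _ K(1)])
        (use K(2) zt test_function_continuous[OF \<psi>] in \<open>auto intro!: continuous_on_mult\<close>)
    have "(LINT x|lebesgue. \<psi> x * ((z (x + t *\<^sub>R axis i 1) - z x) / t)) =
        (LINT x|lebesgue. (z (x + t *\<^sub>R axis i 1) * \<psi> x - z (x + 0 *\<^sub>R axis i 1) * \<psi> x) / t)"
      by (rule Bochner_Integration.integral_cong) (auto simp: algebra_simps)
    also have "\<dots> = (\<theta> t - \<theta> 0) / t"
      using i[of t] i[of 0] by (simp add: \<theta>t)
    finally show ?thesis by simp
  qed
  have "((\<lambda>t. (\<theta> (0 + t) - \<theta> 0) / t) \<longlongrightarrow> - (LINT x|lebesgue. z x * partial_deriv i \<psi> x)) (at 0)"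
    using DERIV_integral_shift[OF z \<psi>, of i 0] unfolding \<theta>_def DERIV_def by simp
  then show ?thesis unfolding eq .
qed

section \<open>Cutoffs and smooth approximation with controlled support\<close>

lemma continuous_on_cutoff:
  fixes k :: "'a::metric_space \<Rightarrow> real"
  assumes "continuous_on UNIV k" "\<And>x. dist p x = r \<Longrightarrow> k x = 0"
  shows "continuous_on UNIV (\<lambda>x. if x \<in> cball p r then k x else 0)"
proof -
  have "continuous_on (cball p r \<union> - ball p r) (\<lambda>x. if x \<in> cball p r then k x else 0)"
    by (rule continuous_on_cases)
      (use assms(2) in \<open>auto simp: closed_Compl intro: continuous_on_subset[OF assms(1)]\<close>)
  moreover have "cball p r \<union> - ball p r = UNIV" by auto
  ultimately show ?thesis by simp
qed

text \<open>Divide by a bump that is positive on the support, apply Stone--Weierstrass to the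
  quotient, and multiply back.\<close>

lemma smooth_approximation:
  fixes h :: "real^'n::finite \<Rightarrow> real"
  assumes h: "continuous_on UNIV h" "\<And>x. x \<notin> ball p r \<Longrightarrow> h x = 0" and "r < R" "0 < R" "0 < \<eta>"
  obtains \<psi> where "smooth_term \<psi>" "\<And>x. x \<notin> ball p R \<Longrightarrow> \<psi> x = 0" "\<And>x. \<bar>h x - \<psi> x\<bar> \<le> \<eta>"
proof -
  have bpos: "0 < bump p R x" if "x \<in> cball p r" for x
    using that \<open>r < R\<close> \<open>0 < R\<close> by (subst bump_pos_iff) auto
  have bc: "continuous_on UNIV (bump p R)"
    using smooth_term_C_k[OF smooth_term_bump, of 0] by simp
  define k where "k x = (if x \<in> cball p r then h x / bump p R x else 0)" for x
  have "continuous_on (cball p r \<union> - ball p r) k"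
    unfolding k_def
  proof (rule continuous_on_cases)
    show "continuous_on (cball p r) (\<lambda>x. h x / bump p R x)"
      using bpos by (intro continuous_on_divide continuous_on_subset[OF h(1)] continuous_on_subset[OF bc]) force+
  qed (use h(2) in auto)
  moreover have "cball p r \<union> - ball p r = UNIV" by auto
  ultimately have kc: "continuous_on UNIV k" by simp
  obtain P where P: "real_polynomial_function P" "\<And>x. x \<in> cball p R \<Longrightarrow> \<bar>k x - P x\<bar> < \<eta>"
    using Stone_Weierstrass_real_polynomial_function[OF compact_cball continuous_on_subset[OF kc] \<open>0 < \<eta>\<close>]
    by (metis subset_UNIV)
  show thesis
  proof
    show "smooth_term (\<lambda>x. P x * bump p R x)"
      by (intro smooth_term.mult smooth_term_polynomial P smooth_term_bump)
    show zero: "P x * bump p R x = 0" if "x \<notin> ball p R" for x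
      using bump_eq_0[OF \<open>0 < R\<close> that] by simp
    show "\<bar>h x - P x * bump p R x\<bar> \<le> \<eta>" for x
    proof (cases "x \<in> ball p R")
      case True
      have hk: "h x = k x * bump p R x"
        using bpos[of x] h(2)[of x] by (auto simp: k_def)
      have "\<bar>h x - P x * bump p R x\<bar> = \<bar>k x - P x\<bar> * bump p R x"
        unfolding hk using bump_nonneg[of p R x] by (simp add: abs_mult flip: left_diff_distrib)
      also have "\<dots> \<le> \<eta> * 1"
        using P(2)[of x] True bump_nonneg[of p R x] flat_one_le_one
        by (intro mult_mono) (auto simp: bump_def)
      finally show ?thesis by simp
    next
      case False
      then have "h x = 0" using h(2)[of x] \<open>r < R\<close> by auto
      then show ?thesis unfolding zero[OF False] using \<open>0 < \<eta>\<close> by simp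
    qed
  qed
qed

section \<open>Functions with a bounded weak partial derivative on a ball\<close>

text \<open>The functions live on the whole space so that they can be translated freely, but the
  weak derivative along the single axis \<open>i\<close> is tested only inside the ball. The
  intended \<open>z\<close> is the paraboloid minus \<open>\<sigma> * u\<close>.\<close>

locale weak_partial =
  fixes i :: "'n::finite" and p :: "real^'n" and \<rho> :: real
    and z Z :: "real^'n \<Rightarrow> real" and C :: real
  assumes \<rho>: "0 < \<rho>" and C: "0 \<le> C"
    and z: "continuous_on UNIV z"
    and Z: "Z \<in> borel_measurable lebesgue" "AE x in lebesgue. \<bar>Z x\<bar> \<le> C"
    and weak: "\<And>\<psi>. \<psi> \<in> test_functions (ball p \<rho>) \<Longrightarrow>
      (LINT x|lebesgue. z x * partial_deriv i \<psi> x) = - (LINT x|lebesgue. Z x * \<psi> x)"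
begin

abbreviation e :: "real^'n" where "e \<equiv> axis i 1"

lemma continuous_z_shift: "continuous_on UNIV (\<lambda>x. z (x + t *\<^sub>R e))"
  by (rule continuous_on_compose2[OF z]) (auto intro!: continuous_intros)

lemma bump_test:
  assumes "0 < r" "dist p q + r < \<rho>"
  shows "bump q r \<in> test_functions (ball p \<rho>)"
proof (rule smooth_term_test_function[OF smooth_term_bump compact_cball])
  show "cball q r \<subseteq> ball p \<rho>"
  proof
    fix y assume "y \<in> cball q r"
    then show "y \<in> ball p \<rho>" using dist_triangle[of p y q] assms by auto
  qed
  show "bump q r y = 0" if "y \<notin> cball q r" for y
    using that assms by (intro bump_eq_0) auto
qed

lemma bump_continuous: "continuous_on UNIV (bump q r)"
  using smooth_term_C_k[OF smooth_term_bump, of 0] by simp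

text \<open>An averaged Lipschitz estimate. Sliding the bump from \<open>x\<close> to
  \<open>x + t *\<^sub>R e\<close> gives a function of \<open>s\<close> whose derivative is the
  integral of \<open>Z\<close> against the shifted bump, hence at most \<open>C\<close> times the
  mass of the bump; the mean value bound does the rest.\<close>

lemma bump_integral_bound:
  assumes "0 < r" "dist p x + r < \<rho>" "dist p (x + t *\<^sub>R e) + r < \<rho>"
  shows "\<bar>LINT y|lebesgue. (z (y + t *\<^sub>R e) - z y) * bump x r y\<bar> \<le> C * \<bar>t\<bar> * integral\<^sup>L lebesgue (bump x r)"
proof -
  define I where "I = integral\<^sup>L lebesgue (bump x r)"
  define \<theta> where "\<theta> s = (LINT y|lebesgue. z y * bump x r (y - s *\<^sub>R e))" for s
  \<comment> \<open>Convexity of the ball of radius \<open>\<rho> - r\<close>: every intermediate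
    bump is still an admissible test function.\<close>
  have dist_seg: "dist p (x + s *\<^sub>R e) + r < \<rho>" if "s \<in> closed_segment 0 t" for s
  proof -
    have "x + s *\<^sub>R e \<in> closed_segment x (x + t *\<^sub>R e)"
      using that by (auto simp: in_segment algebra_simps)
    then have "x + s *\<^sub>R e \<in> ball p (\<rho> - r)"
      using closed_segment_subset[of x "ball p (\<rho> - r)" "x + t *\<^sub>R e"] assms by auto
    then show ?thesis by simp
  qed
  have bt: "bump q r y = 0" if "y \<notin> cball q r" for q y :: "real^'n"
    using that assms(1) by (intro bump_eq_0) auto
  have \<theta>t: "\<theta> s = (LINT y|lebesgue. z (y + s *\<^sub>R e) * bump x r y)" for s
    using continuous_integral_translate[of "\<lambda>y. z y * bump x r (y - s *\<^sub>R e)" "s *\<^sub>R e"] unfolding \<theta>_def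
    by (simp add: z continuous_on_mult bump_continuous continuous_on_compose2[OF bump_continuous]
        continuous_intros)
  have ib: "integrable lebesgue (bump q r)" for q :: "real^'n"
    using continuous_compact_integrable(2)[OF bump_continuous compact_cball bt] .
  have bI: "integral\<^sup>L lebesgue (bump (x + s *\<^sub>R e) r) = I" for s
    unfolding I_def
    using continuous_integral_translate[OF bump_continuous[of "x + s *\<^sub>R e" r], of "s *\<^sub>R e"]
      bump_translate[of x r _ "s *\<^sub>R e", symmetric] by simp
  have der: "(\<theta> has_real_derivative (LINT y|lebesgue. Z y * bump (x + s *\<^sub>R e) r y)) (at s)"
    "\<bar>LINT y|lebesgue. Z y * bump (x + s *\<^sub>R e) r y\<bar> \<le> C * I" if "s \<in> closed_segment 0 t" for s
  proof -
    have b: "bump x r \<in> test_functions (ball p \<rho>)" "bump (x + s *\<^sub>R e) r \<in> test_functions (ball p \<rho>)"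
      using bump_test assms dist_seg[OF that] by auto
    have "(\<lambda>y. bump x r (y - s *\<^sub>R e)) = bump (x + s *\<^sub>R e) r"
      by (rule ext, rule bump_translate)
    then have "partial_deriv i (bump (x + s *\<^sub>R e) r) y = partial_deriv i (bump x r) (y - s *\<^sub>R e)" for y
      using partial_deriv_translate[OF test_function_differentiable[OF b(1)], where i=i and x=y and a="s *\<^sub>R e"] by (simp only:)
    then show "(\<theta> has_real_derivative (LINT y|lebesgue. Z y * bump (x + s *\<^sub>R e) r y)) (at s)"
      using DERIV_integral_shift[OF z b(1), of i s] weak[OF b(2)] unfolding \<theta>_def by simp
    have "\<bar>LINT y|lebesgue. Z y * bump (x + s *\<^sub>R e) r y\<bar> \<le> (LINT y|lebesgue. C * bump (x + s *\<^sub>R e) r y)"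
    proof (rule order_trans[OF integral_norm_bound[where 'a=real, unfolded real_norm_def]], rule integral_mono_AE)
      show "integrable lebesgue (\<lambda>y. \<bar>Z y * bump (x + s *\<^sub>R e) r y\<bar>)"
        by (intro integrable_abs integrable_bounded_mult_continuous[OF Z bump_continuous compact_cball bt])
      show "integrable lebesgue (\<lambda>y. C * bump (x + s *\<^sub>R e) r y)" using ib by simp
      show "AE y in lebesgue. \<bar>Z y * bump (x + s *\<^sub>R e) r y\<bar> \<le> C * bump (x + s *\<^sub>R e) r y"
        using Z(2) by eventually_elim (auto simp: abs_mult bump_nonneg intro!: mult_right_mono)
    qed
    then show "\<bar>LINT y|lebesgue. Z y * bump (x + s *\<^sub>R e) r y\<bar> \<le> C * I" by (simp add: bI)
  qed
  have "norm (\<theta> t - \<theta> 0) \<le> C * I * norm (t - 0)"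
    by (rule field_differentiable_bound[OF convex_closed_segment[of 0 t]])
      (use der in \<open>auto intro: has_field_derivative_at_within\<close>)
  moreover have "integrable lebesgue (\<lambda>y. z (y + s *\<^sub>R e) * bump x r y)" for s
    by (rule continuous_compact_integrable(2)[OF _ compact_cball[of x r]])
      (use bt continuous_z_shift bump_continuous in \<open>auto intro!: continuous_on_mult\<close>)
  from this[of t] this[of 0] have "\<theta> t - \<theta> 0 = (LINT y|lebesgue. (z (y + t *\<^sub>R e) - z y) * bump x r y)"
    by (simp add: \<theta>t left_diff_distrib)
  ultimately show ?thesis by (simp add: I_def mult_ac)
qed

text \<open>If the bound failed at \<open>x\<close>, then by continuity it would fail, with the same
  sign \<open>s\<close>, on a whole small ball around \<open>x\<close>. Integrating the positive
  excess \<open>k\<close> against a bump supported there contradicts the averaged estimate.\<close>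

lemma lipschitz_along_axis:
  assumes "x \<in> ball p \<rho>" "x + t *\<^sub>R e \<in> ball p \<rho>"
  shows "\<bar>z (x + t *\<^sub>R e) - z x\<bar> \<le> C * \<bar>t\<bar>"
proof -
  have "s * (z (x + t *\<^sub>R e) - z x) \<le> C * \<bar>t\<bar>" if s: "\<bar>s\<bar> = 1" for s
  proof (rule ccontr)
    define k where "k y = s * (z (y + t *\<^sub>R e) - z y) - C * \<bar>t\<bar>" for y
    assume "\<not> s * (z (x + t *\<^sub>R e) - z x) \<le> C * \<bar>t\<bar>"
    then have kx: "k x > 0" by (simp add: k_def)
    have kc: "continuous_on UNIV k"
      unfolding k_def by (intro continuous_intros continuous_z_shift z)
    then have "open {y. k y > 0}"
      by (intro open_Collect_less continuous_intros)
    then obtain r1 where r1: "r1 > 0" "\<And>y. y \<in> ball x r1 \<Longrightarrow> k y > 0"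
      using kx unfolding open_contains_ball by (metis mem_Collect_eq subsetD)
    define r where "r = min r1 (min (\<rho> - dist p x) (\<rho> - dist p (x + t *\<^sub>R e))) / 2"
    have r: "r > 0" "r \<le> r1" "dist p x + r < \<rho>" "dist p (x + t *\<^sub>R e) + r < \<rho>"
    proof -
      have "r \<le> r1 / 2" "r \<le> (\<rho> - dist p x) / 2" "r \<le> (\<rho> - dist p (x + t *\<^sub>R e)) / 2"
        unfolding r_def by (intro divide_right_mono; simp add: min_le_iff_disj)+
      then show "r \<le> r1" "dist p x + r < \<rho>" "dist p (x + t *\<^sub>R e) + r < \<rho>"
        using assms r1(1) by auto
      show "r > 0" using assms r1(1) by (auto simp: r_def)
    qed
    have bt: "bump x r y = 0" if "y \<notin> cball x r" for y
      using that r by (intro bump_eq_0) auto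
    let ?D = "\<lambda>y. (z (y + t *\<^sub>R e) - z y) * bump x r y"
    have Di: "integrable lebesgue ?D" "integrable lebesgue (bump x r)"
      by (rule continuous_compact_integrable(2)[OF _ compact_cball[of x r]];
          use bt continuous_z_shift z bump_continuous in \<open>auto intro!: continuous_on_mult continuous_on_diff\<close>)+
    have "0 < (LINT y|lebesgue. k y * bump x r y)"
    proof (rule continuous_integral_pos)
      show "continuous_on UNIV (\<lambda>y. k y * bump x r y)" by (intro continuous_on_mult kc bump_continuous)
      show "0 \<le> k y * bump x r y" for y
      proof (cases "y \<in> ball x r")
        case True
        then show ?thesis using r1(2)[of y] r(2) bump_nonneg[of x r y] by auto
      qed (simp add: bump_eq_0[OF r(1)])
      show "0 < k x * bump x r x" using kx bump_pos_iff[OF r(1), of x x] r(1) by simp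
      show "k y * bump x r y = 0" if "y \<notin> cball x r" for y using bt[OF that] by simp
    qed simp
    also have "(\<lambda>y. k y * bump x r y) = (\<lambda>y. s * ?D y - C * \<bar>t\<bar> * bump x r y)"
      by (auto simp: k_def algebra_simps)
    also have "integral\<^sup>L lebesgue \<dots> = s * integral\<^sup>L lebesgue ?D - C * \<bar>t\<bar> * integral\<^sup>L lebesgue (bump x r)"
      using Di by simp
    also have "s * integral\<^sup>L lebesgue ?D \<le> \<bar>integral\<^sup>L lebesgue ?D\<bar>"
      using s abs_ge_self[of "s * integral\<^sup>L lebesgue ?D"] by (simp add: abs_mult)
    finally show False using bump_integral_bound[OF r(1,3,4)] by linarith
  qed
  from this[of 1] this[of "-1"] show ?thesis by (simp add: abs_le_iff)
qed

text \<open>For smooth \<open>h\<close> the limit follows from the definition of the weak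
  derivative. A continuous \<open>h\<close> is uniformly approximated by smooth functions, and the
  error is uniform in \<open>t\<close> because the quotients are bounded by \<open>C\<close>, thanks
  to the Lipschitz bound along the axis.\<close>

lemma difference_quotient_tendsto_weakly:
  assumes h: "continuous_on UNIV h" "\<And>x. x \<notin> ball p (\<rho> / 2) \<Longrightarrow> h x = 0"
  shows "((\<lambda>t. LINT x|lebesgue. h x * ((z (x + t *\<^sub>R e) - z x) / t)) \<longlongrightarrow> (LINT x|lebesgue. h x * Z x)) (at 0)"
proof (rule tendstoI)
  fix \<epsilon> :: real assume "0 < \<epsilon>"
  let ?B = "cball p (3 / 4 * \<rho>)"
  define V where "V = measure lebesgue ?B"
  have V: "0 \<le> V" by (simp add: V_def)
  \<comment> \<open>Chosen to make \<open>\<eta> * C * V < \<epsilon> / 3\<close>; the added 1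
    covers the case \<open>C * V = 0\<close>.\<close>
  define \<eta> where "\<eta> = \<epsilon> / (3 * (C * V + 1))"
  have "0 < \<eta>" using \<open>0 < \<epsilon>\<close> V C by (auto simp: \<eta>_def intro!: divide_pos_pos add_nonneg_pos)
  have "\<eta> * C * V < \<epsilon> / 3"
  proof -
    have "0 \<le> C * V" using C V by simp
    then have "\<epsilon> * (C * V) / (C * V + 1) < \<epsilon>" using \<open>0 < \<epsilon>\<close> by (simp add: field_simps)
    moreover have "\<eta> * C * V = \<epsilon> * (C * V) / (C * V + 1) / 3"
      by (simp add: \<eta>_def mult_ac)
    ultimately show ?thesis using divide_strict_right_mono[of "\<epsilon> * (C * V) / (C * V + 1)" \<epsilon> 3] by simp
  qed
  \<comment> \<open>The support may grow from radius \<open>\<rho> / 2\<close> to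
    \<open>3 / 4 * \<rho>\<close>; with \<open>\<bar>t\<bar> < \<rho> / 4\<close> the shifted points
    still lie in the ball where the Lipschitz bound holds.\<close>
  obtain \<psi> where \<psi>: "smooth_term \<psi>" "\<And>x. x \<notin> ball p (3 / 4 * \<rho>) \<Longrightarrow> \<psi> x = 0" "\<And>x. \<bar>h x - \<psi> x\<bar> \<le> \<eta>"
  proof (rule smooth_approximation[of h p "\<rho> / 2" "3 / 4 * \<rho>" \<eta>])
  qed (use h \<rho> \<open>0 < \<eta>\<close> in auto)
  have \<psi>t: "\<psi> \<in> test_functions (ball p \<rho>)"
    by (rule smooth_term_test_function[OF \<psi>(1) compact_cball[of p "3 / 4 * \<rho>"]]) (use \<psi>(2) \<rho> in auto)
  note \<psi>c = test_function_continuous[OF \<psi>t]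
  have \<psi>0: "\<psi> x = 0" and h0: "h x = 0" if "x \<notin> ?B" for x
    using that \<psi>(2)[of x] h(2)[of x] \<rho> by auto
  have bd: "\<bar>(h x - \<psi> x) * w\<bar> \<le> \<eta> * C * indicator ?B x" if "x \<in> ?B \<Longrightarrow> \<bar>w\<bar> \<le> C" for x w
  proof (cases "x \<in> ?B")
    case True
    then show ?thesis
      using that \<psi>(3)[of x] \<open>0 < \<eta>\<close> by (auto simp: abs_mult intro!: mult_mono)
  qed (simp add: \<psi>0 h0)
  have iZ: "integrable lebesgue (\<lambda>x. h x * Z x)" "integrable lebesgue (\<lambda>x. \<psi> x * Z x)"
    using integrable_bounded_mult_continuous[OF Z h(1) compact_cball[of p "3 / 4 * \<rho>"] h0]
      integrable_bounded_mult_continuous[OF Z \<psi>c compact_cball[of p "3 / 4 * \<rho>"] \<psi>0] by (simp_all add: mult.commute)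
  have "\<bar>LINT x|lebesgue. (h x - \<psi> x) * Z x\<bar> \<le> \<eta> * C * V"
    unfolding V_def
  proof (rule integral_abs_bound_on_set)
    show "AE x in lebesgue. \<bar>(h x - \<psi> x) * Z x\<bar> \<le> \<eta> * C * indicator ?B x"
      using Z(2) by eventually_elim (rule bd)
  qed (use \<open>0 < \<eta>\<close> C in auto)
  then have d1: "\<bar>(LINT x|lebesgue. h x * Z x) - (LINT x|lebesgue. \<psi> x * Z x)\<bar> < \<epsilon> / 3"
    using iZ \<open>\<eta> * C * V < \<epsilon> / 3\<close> by (simp add: left_diff_distrib)
  let ?q = "\<lambda>t x. (z (x + t *\<^sub>R e) - z x) / t"
  have d2: "\<bar>(LINT x|lebesgue. h x * ?q t x) - (LINT x|lebesgue. \<psi> x * ?q t x)\<bar> < \<epsilon> / 3"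
    if t: "t \<noteq> 0" "\<bar>t\<bar> < \<rho> / 4" for t
  proof -
    have qc: "continuous_on UNIV (?q t)" using t by (intro continuous_intros continuous_z_shift z) auto
    have "\<bar>?q t x\<bar> \<le> C" if "x \<in> ?B" for x
    proof -
      have "dist p (x + t *\<^sub>R e) \<le> dist p x + \<bar>t\<bar>"
        using norm_triangle_ineq4[of "p - x" "t *\<^sub>R e"] by (simp add: dist_norm norm_axis_1 algebra_simps)
      then have "\<bar>z (x + t *\<^sub>R e) - z x\<bar> \<le> C * \<bar>t\<bar>"
        using that t \<rho> by (intro lipschitz_along_axis) auto
      then show ?thesis using t by (simp add: field_simps)
    qed
    then have "\<bar>LINT x|lebesgue. (h x - \<psi> x) * ?q t x\<bar> \<le> \<eta> * C * V"
      unfolding V_def by (intro integral_abs_bound_on_set AE_I2 bd) (use \<open>0 < \<eta>\<close> C in auto)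
    moreover have "integrable lebesgue (\<lambda>x. h x * ?q t x)" "integrable lebesgue (\<lambda>x. \<psi> x * ?q t x)"
      using h0 \<psi>0 by (auto intro!: continuous_compact_integrable(2)[OF _ compact_cball[of p "3 / 4 * \<rho>"]]
          continuous_on_mult[OF h(1) qc] continuous_on_mult[OF \<psi>c qc] simp del: times_divide_eq_right)
    then have "(LINT x|lebesgue. (h x - \<psi> x) * ?q t x) = (LINT x|lebesgue. h x * ?q t x) - (LINT x|lebesgue. \<psi> x * ?q t x)"
      unfolding left_diff_distrib by (rule Bochner_Integration.integral_diff)
    ultimately show ?thesis using \<open>\<eta> * C * V < \<epsilon> / 3\<close> by linarith
  qed
  have "((\<lambda>t. LINT x|lebesgue. \<psi> x * ?q t x) \<longlongrightarrow> (LINT x|lebesgue. \<psi> x * Z x)) (at 0)"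
    using difference_quotient_integral_tendsto[OF z \<psi>t, of i] weak[OF \<psi>t] by (simp add: mult.commute)
  then have "\<forall>\<^sub>F t in at 0. dist (LINT x|lebesgue. \<psi> x * ?q t x) (LINT x|lebesgue. \<psi> x * Z x) < \<epsilon> / 3"
    using \<open>0 < \<epsilon>\<close> by (intro tendstoD) auto
  moreover have "\<forall>\<^sub>F t in at 0. t \<noteq> 0 \<and> \<bar>t\<bar> < \<rho> / 4"
    using \<rho> by (auto simp: eventually_at intro!: exI[of _ "\<rho> / 4"])
  ultimately show "\<forall>\<^sub>F t in at 0. dist (LINT x|lebesgue. h x * ?q t x) (LINT x|lebesgue. h x * Z x) < \<epsilon>"
  proof eventually_elim
    case (elim t)
    from elim(1) d1 d2[of t] elim(2) show ?case unfolding dist_real_def by linarith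
  qed
qed

end

section \<open>Chain rule for the squared positive part\<close>

text \<open>The squared positive part is differentiable with Lipschitz derivative, so its
  first-order remainder is quadratic even across the kink of \<open>max 0\<close>.\<close>

lemma square_positive_part_taylor:
  fixes a b c :: real
  assumes "0 \<le> c"
  shows "\<bar>c * (max 0 b)\<^sup>2 - c * (max 0 a)\<^sup>2 - 2 * c * max 0 a * (b - a)\<bar> \<le> c * (b - a)\<^sup>2"
proof -
  have "\<bar>(max 0 b)\<^sup>2 - (max 0 a)\<^sup>2 - 2 * max 0 a * (b - a)\<bar> \<le> (b - a)\<^sup>2"
  proof (cases "0 \<le> a"; cases "0 \<le> b")
    assume "0 \<le> a" "0 \<le> b"
    moreover have "b\<^sup>2 - a\<^sup>2 - 2 * a * (b - a) = (b - a)\<^sup>2"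
      by (simp add: power2_eq_square algebra_simps)
    ultimately show ?thesis by simp
  next
    assume a: "0 \<le> a" "\<not> 0 \<le> b"
    then have "a * b \<le> 0" by (simp add: mult_nonneg_nonpos)
    moreover have "(max 0 b)\<^sup>2 - (max 0 a)\<^sup>2 - 2 * max 0 a * (b - a) = a\<^sup>2 - 2 * (a * b)"
      using a by (simp add: power2_eq_square algebra_simps)
    moreover have "(b - a)\<^sup>2 = a\<^sup>2 - 2 * (a * b) + b\<^sup>2" by (simp add: power2_eq_square algebra_simps)
    ultimately show ?thesis using zero_le_power2[of a] zero_le_power2[of b] by linarith
  next
    assume a: "\<not> 0 \<le> a" "0 \<le> b"
    then have "a * b \<le> 0" by (simp add: mult_nonpos_nonneg)
    moreover have "(max 0 b)\<^sup>2 - (max 0 a)\<^sup>2 - 2 * max 0 a * (b - a) = b\<^sup>2"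
      using a by simp
    moreover have "(b - a)\<^sup>2 = a\<^sup>2 - 2 * (a * b) + b\<^sup>2" by (simp add: power2_eq_square algebra_simps)
    ultimately show ?thesis using zero_le_power2[of a] zero_le_power2[of b] by linarith
  qed auto
  then have "c * \<bar>(max 0 b)\<^sup>2 - (max 0 a)\<^sup>2 - 2 * max 0 a * (b - a)\<bar> \<le> c * (b - a)\<^sup>2"
    using assms by (rule mult_left_mono)
  moreover have "c * \<bar>(max 0 b)\<^sup>2 - (max 0 a)\<^sup>2 - 2 * max 0 a * (b - a)\<bar> =
      \<bar>c * ((max 0 b)\<^sup>2 - (max 0 a)\<^sup>2 - 2 * max 0 a * (b - a))\<bar>"
    using assms by (simp add: abs_mult)
  ultimately show ?thesis by (simp add: algebra_simps)
qed

context weak_partial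
begin

text \<open>The difference quotients of \<open>\<phi>\<close> and \<open>\<phi>'\<close> times those
  of \<open>z\<close> differ by \<open>O(t)\<close>, by the Taylor bound and the Lipschitz estimate.
  The former converge by translation; the latter converge weakly because
  \<open>\<phi>' * \<psi>\<close> is continuous and vanishes off the half ball. This last fact also
  lets \<open>\<psi>\<close> be supported anywhere.\<close>

lemma weak_chain_rule_square_positive_part:
  fixes c :: real
  assumes c: "0 \<le> c"
    and neg: "\<And>x. x \<in> ball p \<rho> \<Longrightarrow> x \<notin> ball p (\<rho> / 2) \<Longrightarrow> z x \<le> 0"
    and \<psi>: "\<psi> \<in> test_functions \<Omega>"
  defines "\<phi> \<equiv> \<lambda>x. if x \<in> cball p (\<rho> / 2) then c * (max 0 (z x))\<^sup>2 else 0"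
  defines "\<phi>' \<equiv> \<lambda>x. if x \<in> cball p (\<rho> / 2) then 2 * c * max 0 (z x) else 0"
  shows "(LINT x|lebesgue. \<phi> x * partial_deriv i \<psi> x) = - (LINT x|lebesgue. \<phi>' x * Z x * \<psi> x)"
proof -
  have sphere: "z x \<le> 0" if "dist p x = \<rho> / 2" for x
    using neg[of x] that \<rho> by simp
  have \<phi>c: "continuous_on UNIV \<phi>" and \<phi>'c: "continuous_on UNIV \<phi>'"
    unfolding \<phi>_def \<phi>'_def
    by (intro continuous_on_cutoff continuous_intros z; use sphere in force)+
  note \<psi>c = test_function_continuous[OF \<psi>]
  \<comment> \<open>By \<open>neg\<close> the positive part already vanishes between the two radii,
    so inside the large ball the cutoff is invisible and the Taylor bound applies to
    \<open>\<phi>\<close> itself.\<close>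
  have \<phi>_ball: "\<phi> x = c * (max 0 (z x))\<^sup>2" "\<phi>' x = 2 * c * max 0 (z x)" if "x \<in> ball p \<rho>" for x
    using neg[of x] that by (auto simp: \<phi>_def \<phi>'_def)
  have \<phi>_out: "\<phi> x = 0" "\<phi>' x = 0" if "x \<notin> ball p (\<rho> / 2)" for x
    using that sphere[of x] by (auto simp: \<phi>_def \<phi>'_def max_def)
  let ?B = "cball p \<rho>"
  define V where "V = measure lebesgue ?B"
  obtain M where M: "0 < M" "\<And>x. x \<in> ?B \<Longrightarrow> \<bar>\<psi> x\<bar> \<le> M"
    using compact_imp_bounded[OF compact_continuous_image[OF continuous_on_subset[OF \<psi>c subset_UNIV] compact_cball[of p \<rho>]]]
    unfolding bounded_pos by (auto simp del: mem_cball)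
  let ?q = "\<lambda>f t x. (f (x + t *\<^sub>R e) - f x) / t"
  have close: "\<bar>(LINT x|lebesgue. \<psi> x * ?q \<phi> t x) - (LINT x|lebesgue. (\<phi>' x * \<psi> x) * ?q z t x)\<bar> \<le> M * c * C\<^sup>2 * V * \<bar>t\<bar>"
    if t: "t \<noteq> 0" "\<bar>t\<bar> < \<rho> / 4" for t
  proof -
    have pt: "\<bar>\<phi> (x + t *\<^sub>R e) - \<phi> x - \<phi>' x * (z (x + t *\<^sub>R e) - z x)\<bar> \<le> c * C\<^sup>2 * t\<^sup>2 * indicator ?B x" for x
    proof (cases "x \<in> ball p (3 / 4 * \<rho>)")
      case True
      have "dist p (x + t *\<^sub>R e) \<le> dist p x + \<bar>t\<bar>"
        using norm_triangle_ineq4[of "p - x" "t *\<^sub>R e"] by (simp add: dist_norm norm_axis_1 algebra_simps)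
      then have b: "x \<in> ball p \<rho>" "x + t *\<^sub>R e \<in> ball p \<rho>" using True t \<rho> by auto
      have "\<bar>\<phi> (x + t *\<^sub>R e) - \<phi> x - \<phi>' x * (z (x + t *\<^sub>R e) - z x)\<bar> \<le> c * (z (x + t *\<^sub>R e) - z x)\<^sup>2"
        unfolding \<phi>_ball[OF b(1)] \<phi>_ball[OF b(2)] by (rule square_positive_part_taylor[OF c])
      also have "\<dots> \<le> c * (C * \<bar>t\<bar>)\<^sup>2"
        using lipschitz_along_axis[OF b] c C by (intro mult_left_mono) (auto simp: abs_le_square_iff[symmetric] abs_mult)
      finally show ?thesis using b(1) by (simp add: power_mult_distrib)
    next
      \<comment> \<open>A shift by less than \<open>\<rho> / 4\<close> cannot carry such a point
        into the half ball, so all terms vanish.\<close>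
      case False
      have "dist p x \<le> dist p (x + t *\<^sub>R e) + \<bar>t\<bar>"
        using norm_triangle_ineq[of "p - (x + t *\<^sub>R e)" "t *\<^sub>R e"] by (simp add: dist_norm norm_axis_1 algebra_simps)
      then have "x \<notin> ball p (\<rho> / 2)" "x + t *\<^sub>R e \<notin> ball p (\<rho> / 2)" using False t \<rho> by auto
      then show ?thesis using c by (simp add: \<phi>_out)
    qed
    have "\<bar>LINT x|lebesgue. \<psi> x * ?q \<phi> t x - (\<phi>' x * \<psi> x) * ?q z t x\<bar> \<le> M * c * C\<^sup>2 * \<bar>t\<bar> * V"
      unfolding V_def
    proof (rule integral_abs_bound_on_set)
      show "AE x in lebesgue. \<bar>\<psi> x * ?q \<phi> t x - (\<phi>' x * \<psi> x) * ?q z t x\<bar> \<le> M * c * C\<^sup>2 * \<bar>t\<bar> * indicator ?B x"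
      proof (rule AE_I2)
        fix x
        let ?d = "\<phi> (x + t *\<^sub>R e) - \<phi> x - \<phi>' x * (z (x + t *\<^sub>R e) - z x)"
        have "\<psi> x * ?q \<phi> t x - (\<phi>' x * \<psi> x) * ?q z t x = \<psi> x * (?d / t)"
          using t(1) by (simp add: field_simps)
        then have eq: "\<bar>\<psi> x * ?q \<phi> t x - (\<phi>' x * \<psi> x) * ?q z t x\<bar> = \<bar>\<psi> x\<bar> * (\<bar>?d\<bar> / \<bar>t\<bar>)"
          by (simp add: abs_mult)
        show "\<bar>\<psi> x * ?q \<phi> t x - (\<phi>' x * \<psi> x) * ?q z t x\<bar> \<le> M * c * C\<^sup>2 * \<bar>t\<bar> * indicator ?B x"
        proof (cases "x \<in> ?B")
          case True
          have "\<bar>?d\<bar> / \<bar>t\<bar> \<le> c * C\<^sup>2 * t\<^sup>2 / \<bar>t\<bar>"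
            using pt[of x] True by (intro divide_right_mono) auto
          also have "\<dots> = c * C\<^sup>2 * \<bar>t\<bar>" using t(1) by (simp add: power2_eq_square field_simps abs_if)
          finally have "\<bar>\<psi> x\<bar> * (\<bar>?d\<bar> / \<bar>t\<bar>) \<le> M * (c * C\<^sup>2 * \<bar>t\<bar>)"
            using M True by (intro mult_mono) auto
          then show ?thesis unfolding eq using True by (simp add: mult_ac)
        next
          case False
          then have "\<bar>?d\<bar> \<le> 0" using pt[of x] by (simp del: abs_le_zero_iff)
          then show ?thesis unfolding eq using False by simp
        qed
      qed
    qed (use M c in auto)
    moreover have "integrable lebesgue (\<lambda>x. \<psi> x * ?q \<phi> t x)"
      "integrable lebesgue (\<lambda>x. (\<phi>' x * \<psi> x) * ?q z t x)"
    proof -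
      obtain K where K: "compact K" "\<And>x. x \<notin> K \<Longrightarrow> \<psi> x = 0"
        using test_function_support[OF \<psi>] by metis
      have \<phi>s: "continuous_on UNIV (\<lambda>x. \<phi> (x + t *\<^sub>R e))"
        by (rule continuous_on_compose2[OF \<phi>c]) (auto intro!: continuous_intros)
      show "integrable lebesgue (\<lambda>x. \<psi> x * ?q \<phi> t x)"
        by (rule continuous_compact_integrable(2)[OF _ K(1)])
          (use t(1) K(2) in \<open>auto intro!: continuous_intros \<psi>c \<phi>c \<phi>s\<close>)
      show "integrable lebesgue (\<lambda>x. (\<phi>' x * \<psi> x) * ?q z t x)"
        by (rule continuous_compact_integrable(2)[OF _ K(1)])
          (use t(1) K(2) in \<open>auto intro!: continuous_intros \<psi>c \<phi>'c z continuous_z_shift\<close>)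
    qed
    ultimately show ?thesis by (simp add: mult_ac)
  qed
  have "((\<lambda>t. LINT x|lebesgue. \<psi> x * ?q \<phi> t x) \<longlongrightarrow> - (LINT x|lebesgue. \<phi> x * partial_deriv i \<psi> x)) (at 0)"
    by (rule difference_quotient_integral_tendsto[OF \<phi>c \<psi>])
  moreover have "((\<lambda>t. LINT x|lebesgue. (\<phi>' x * \<psi> x) * ?q z t x) \<longlongrightarrow> (LINT x|lebesgue. (\<phi>' x * \<psi> x) * Z x)) (at 0)"
    by (rule difference_quotient_tendsto_weakly) (auto intro!: continuous_on_mult \<phi>'c \<psi>c simp: \<phi>_out)
  ultimately have "((\<lambda>t. (LINT x|lebesgue. \<psi> x * ?q \<phi> t x) - (LINT x|lebesgue. (\<phi>' x * \<psi> x) * ?q z t x))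
      \<longlongrightarrow> - (LINT x|lebesgue. \<phi> x * partial_deriv i \<psi> x) - (LINT x|lebesgue. (\<phi>' x * \<psi> x) * Z x)) (at 0)"
    by (rule tendsto_diff)
  moreover have "((\<lambda>t. (LINT x|lebesgue. \<psi> x * ?q \<phi> t x) - (LINT x|lebesgue. (\<phi>' x * \<psi> x) * ?q z t x)) \<longlongrightarrow> 0) (at 0)"
  proof (rule Lim_null_comparison)
    show "\<forall>\<^sub>F t in at 0. norm ((LINT x|lebesgue. \<psi> x * ?q \<phi> t x) - (LINT x|lebesgue. (\<phi>' x * \<psi> x) * ?q z t x)) \<le> M * c * C\<^sup>2 * V * \<bar>t\<bar>"
      using close \<rho> by (auto simp: eventually_at intro!: exI[of _ "\<rho> / 4"])
    show "((\<lambda>t. M * c * C\<^sup>2 * V * \<bar>t\<bar>) \<longlongrightarrow> 0) (at 0)"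
      by (auto intro!: tendsto_eq_intros)
  qed
  ultimately have "- (LINT x|lebesgue. \<phi> x * partial_deriv i \<psi> x) - (LINT x|lebesgue. (\<phi>' x * \<psi> x) * Z x) = 0"
    by (rule tendsto_unique[OF trivial_limit_at])
  then show ?thesis by (simp add: mult_ac)
qed

end

section \<open>The competitor\<close>

text \<open>The difference quotient of a paraboloid is exactly its derivative minus
  \<open>\<kappa> * t\<close>, so the limit in the discrete integration by parts is
  explicit.\<close>

lemma quadratic_weak_partial:
  fixes p :: "real^'n::finite" and \<delta> \<kappa> :: real
  assumes \<psi>: "\<psi> \<in> test_functions \<Omega>"
  shows "(LINT x|lebesgue. (\<delta> - \<kappa> * (norm (x - p))\<^sup>2) * partial_deriv i \<psi> x) =
      - (LINT x|lebesgue. - (2 * \<kappa> * (x - p) $ i) * \<psi> x)"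
proof -
  let ?w = "\<lambda>x. \<delta> - \<kappa> * (norm (x - p))\<^sup>2" and ?w' = "\<lambda>x. - (2 * \<kappa> * (x - p) $ i)"
  obtain K where K: "compact K" "\<And>x. x \<notin> K \<Longrightarrow> \<psi> x = 0"
    using test_function_support[OF \<psi>] by metis
  note \<psi>c = test_function_continuous[OF \<psi>]
  have int: "integrable lebesgue \<psi>" "integrable lebesgue (\<lambda>x. ?w' x * \<psi> x)"
    by (rule continuous_compact_integrable(2)[OF _ K(1)]; use K(2) \<psi>c in \<open>auto intro!: continuous_intros\<close>)+
  have quot: "(?w (x + t *\<^sub>R axis i 1) - ?w x) / t = ?w' x - \<kappa> * t" if "t \<noteq> 0" for x t
  proof -
    have "x + t *\<^sub>R axis i 1 - p = (x - p) + t *\<^sub>R axis i 1" by simp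
    then have "(norm (x + t *\<^sub>R axis i 1 - p))\<^sup>2 = ((x - p) + t *\<^sub>R axis i 1) \<bullet> ((x - p) + t *\<^sub>R axis i 1)"
      by (simp only: power2_norm_eq_inner)
    also have "\<dots> = (norm (x - p))\<^sup>2 + 2 * t * (x - p) $ i + t\<^sup>2"
      unfolding inner_add_left inner_add_right power2_norm_eq_inner
      by (simp add: inner_axis inner_commute[of "axis i 1"] inner_axis_axis power2_eq_square del: vector_minus_component)
    finally have n: "(norm (x + t *\<^sub>R axis i 1 - p))\<^sup>2 = (norm (x - p))\<^sup>2 + 2 * t * (x - p) $ i + t\<^sup>2" .
    show ?thesis unfolding n using that
      by (simp add: power2_eq_square[of t] field_simps del: vector_minus_component)
  qed
  have "((\<lambda>t. LINT x|lebesgue. \<psi> x * ((?w (x + t *\<^sub>R axis i 1) - ?w x) / t)) \<longlongrightarrow>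
      - (LINT x|lebesgue. ?w x * partial_deriv i \<psi> x)) (at 0)"
    by (rule difference_quotient_integral_tendsto[OF _ \<psi>]) (intro continuous_intros)
  moreover have "\<forall>\<^sub>F t in at 0. (LINT x|lebesgue. \<psi> x * ((?w (x + t *\<^sub>R axis i 1) - ?w x) / t)) =
      (LINT x|lebesgue. ?w' x * \<psi> x) - \<kappa> * t * integral\<^sup>L lebesgue \<psi>"
    unfolding eventually_at_filter
  proof (intro always_eventually allI impI)
    fix t :: real assume "t \<noteq> 0"
    have "(LINT x|lebesgue. \<psi> x * ((?w (x + t *\<^sub>R axis i 1) - ?w x) / t)) =
        (LINT x|lebesgue. ?w' x * \<psi> x - \<kappa> * t * \<psi> x)"
      unfolding quot[OF \<open>t \<noteq> 0\<close>] by (rule Bochner_Integration.integral_cong) (auto simp: algebra_simps)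
    also have "\<dots> = (LINT x|lebesgue. ?w' x * \<psi> x) - (LINT x|lebesgue. \<kappa> * t * \<psi> x)"
      by (rule Bochner_Integration.integral_diff[OF int(2)]) (use int(1) in simp)
    finally show "(LINT x|lebesgue. \<psi> x * ((?w (x + t *\<^sub>R axis i 1) - ?w x) / t)) =
        (LINT x|lebesgue. ?w' x * \<psi> x) - \<kappa> * t * integral\<^sup>L lebesgue \<psi>" by simp
  qed
  ultimately have "((\<lambda>t. (LINT x|lebesgue. ?w' x * \<psi> x) - \<kappa> * t * integral\<^sup>L lebesgue \<psi>) \<longlongrightarrow>
      - (LINT x|lebesgue. ?w x * partial_deriv i \<psi> x)) (at 0)"
    by (rule Lim_transform_eventually)
  moreover have "((\<lambda>t. (LINT x|lebesgue. ?w' x * \<psi> x) - \<kappa> * t * integral\<^sup>L lebesgue \<psi>) \<longlongrightarrow>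
      (LINT x|lebesgue. ?w' x * \<psi> x) - \<kappa> * 0 * integral\<^sup>L lebesgue \<psi>) (at 0)"
    by (intro tendsto_intros)
  ultimately have "- (LINT x|lebesgue. ?w x * partial_deriv i \<psi> x) =
      (LINT x|lebesgue. ?w' x * \<psi> x) - \<kappa> * 0 * integral\<^sup>L lebesgue \<psi>"
    by (rule tendsto_unique[OF trivial_limit_at])
  then show ?thesis by simp
qed

section \<open>Essential bounds and local integrability\<close>

lemma LinfI:
  fixes f :: "real^'n::finite \<Rightarrow> 'b::euclidean_space"
  assumes "f \<in> borel_measurable (lebesgue_on \<Omega>)" "AE x in lebesgue_on \<Omega>. norm (f x) \<le> B"
  shows "f \<in> Linf \<Omega>" "Linf_norm \<Omega> f \<le> ereal B"
proof -
  show b: "Linf_norm \<Omega> f \<le> ereal B"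
    unfolding Linf_norm_def using assms by (intro esssup_I) auto
  show "f \<in> Linf \<Omega>"
    using assms(1) order.strict_trans1[OF b, of \<infinity>] by (simp add: Linf_def)
qed

lemma Linf_AE_bound:
  fixes f :: "real^'n::finite \<Rightarrow> 'b::euclidean_space"
  assumes "Linf_norm \<Omega> f \<le> ereal B"
  shows "AE x in lebesgue_on \<Omega>. norm (f x) \<le> B"
  using esssup_AE[of "\<lambda>x. ereal (norm (f x))" "lebesgue_on \<Omega>"]
proof eventually_elim
  case (elim x)
  then have "ereal (norm (f x)) \<le> ereal B" using assms unfolding Linf_norm_def by (rule order_trans)
  then show ?case by simp
qed

lemma Linf_locally_integrable:
  fixes f :: "real^'n::finite \<Rightarrow> 'b::euclidean_space"
  assumes "open \<Omega>" "f \<in> borel_measurable (lebesgue_on \<Omega>)" "AE x in lebesgue_on \<Omega>. norm (f x) \<le> B"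
  shows "locally_integrable \<Omega> f"
  unfolding locally_integrable_def
proof (intro allI impI, elim conjE)
  fix K assume K: "compact K" "K \<subseteq> \<Omega>"
  have \<Omega>: "\<Omega> \<in> sets lebesgue" using \<open>open \<Omega>\<close> by auto
  have Km: "K \<in> lmeasurable" using K(1) by (rule lmeasurable_compact)
  have "(\<lambda>x. if x \<in> \<Omega> then f x else 0) \<in> borel_measurable lebesgue"
    using borel_measurable_if_I[OF assms(2) \<Omega>] .
  then have m: "(\<lambda>x. indicator K x *\<^sub>R (if x \<in> \<Omega> then f x else 0)) \<in> borel_measurable lebesgue"
    using Km by (intro borel_measurable_scaleR borel_measurable_indicator) (auto simp: fmeasurable_def)
  have "integrable lebesgue (\<lambda>x. indicator K x *\<^sub>R (if x \<in> \<Omega> then f x else 0))"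
  proof (rule Bochner_Integration.integrable_bound[OF _ m])
    show "integrable lebesgue (\<lambda>x. B * indicator K x)"
      using Km by (intro integrable_mult_right integrable_real_indicator) (auto simp: fmeasurable_def)
    have "AE x in lebesgue. x \<in> \<Omega> \<longrightarrow> norm (f x) \<le> B"
      using assms(3) \<Omega> by (subst (asm) AE_restrict_space_iff) auto
    then show "AE x in lebesgue. norm (indicator K x *\<^sub>R (if x \<in> \<Omega> then f x else 0)) \<le> norm (B * indicator K x)"
      by eventually_elim (use K(2) in \<open>auto simp: indicator_def\<close>)
  qed
  also have "(\<lambda>x. indicator K x *\<^sub>R (if x \<in> \<Omega> then f x else 0)) = (\<lambda>x. indicator K x *\<^sub>R f x)"
    using K(2) by (auto simp: indicator_def fun_eq_iff)
  finally show "f absolutely_integrable_on K" by (simp add: set_integrable_def)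
qed

text \<open>Below, \<open>\<sigma>\<close> is the sign of \<open>u\<close> near \<open>p\<close>; \<open>\<kappa>\<close> makes \<open>\<bar>\<nabla>w\<bar> \<le> L\<close> on the ball, \<open>\<delta>\<close> makes \<open>w \<le> 0\<close> off the
  ball of half the radius, and \<open>c\<close> keeps the slope of the smoothed maximum between \<open>0\<close> and \<open>1\<close>.\<close>

lemma eigenfunction_no_one_sided_zero:
  fixes \<Omega> :: "(real^'n::finite) set" and u :: "real^'n \<Rightarrow> real" and l \<sigma> \<rho> :: real
  assumes "open \<Omega>" "bounded \<Omega>" and u: "u \<in> W01inf \<Omega>" and "l > 0"
    and sub: "(\<lambda>x. l * u x) \<in> subdiff_J \<Omega> u"
    and \<sigma>: "\<bar>\<sigma>\<bar> = 1" and \<rho>: "0 < \<rho>" "cball p \<rho> \<subseteq> \<Omega>"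
    and sign: "\<And>x. x \<in> cball p \<rho> \<Longrightarrow> 0 \<le> \<sigma> * u x"
    and "u p = 0" and p: "p \<in> closure {x \<in> \<Omega>. u x \<noteq> 0}"
  shows False
proof -
  have \<Omega>: "\<Omega> \<in> sets lebesgue" using \<open>open \<Omega>\<close> by auto
  have \<sigma>2: "\<sigma> * \<sigma> = 1" using \<sigma> by (metis abs_mult_self_eq mult_1)
  \<comment> \<open>The extension by zero is continuous on the whole space because \<open>u\<close>
    vanishes on the frontier; this permits integrals and translations over the full space.\<close>
  define U where "U x = (if x \<in> \<Omega> then u x else 0)" for x
  have Kc: "compact (closure \<Omega>)" using \<open>bounded \<Omega>\<close> by simp
  have U0: "U x = 0" if "x \<notin> closure \<Omega>" for x
    using that closure_subset[of \<Omega>] by (auto simp: U_def)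
  have Uc: "continuous_on UNIV U"
  proof -
    have "continuous_on (closure \<Omega> \<union> - \<Omega>) U"
      unfolding U_def
    proof (rule continuous_on_cases)
      show "\<forall>x. x \<in> closure \<Omega> \<and> x \<notin> \<Omega> \<or> x \<in> - \<Omega> \<and> x \<in> \<Omega> \<longrightarrow> u x = 0"
        using u \<open>open \<Omega>\<close> by (auto simp: W01inf_def frontier_def interior_open)
    qed (use u \<open>open \<Omega>\<close> in \<open>auto simp: W01inf_def\<close>)
    moreover have "closure \<Omega> \<union> - \<Omega> = UNIV" using closure_subset by auto
    ultimately show ?thesis by simp
  qed
  obtain g where g: "g \<in> Linf \<Omega>" "is_weak_grad \<Omega> u g"
    using u by (auto simp: W01inf_def W1inf_def)
  have g_meas: "g \<in> borel_measurable (lebesgue_on \<Omega>)" using g(1) by (simp add: Linf_def)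
  have u_meas: "u \<in> borel_measurable (lebesgue_on \<Omega>)"
    using u by (simp add: W01inf_def W1inf_def Linf_def)
  \<comment> \<open>\<open>L\<close> plays two roles: it is the pairing of \<open>l * u\<close> with
    \<open>u\<close> and, since \<open>l * u\<close> is a subgradient, also the essential bound of
    the gradient of \<open>u\<close>.\<close>
  define L where "L = L2_inner \<Omega> (\<lambda>x. l * u x) u"
  have "J_fun \<Omega> u = Linf_norm \<Omega> (weak_grad \<Omega> u)" using u by (auto simp: J_fun_def)
  moreover have "ereal L = J_fun \<Omega> u" using sub by (simp add: subdiff_J_def L_def)
  ultimately have gL: "Linf_norm \<Omega> g = ereal L"
    using Linf_norm_weak_grad[OF \<open>open \<Omega>\<close> g(2,1)] by simp
  have g_bound: "AE x in lebesgue_on \<Omega>. norm (g x) \<le> L" by (rule Linf_AE_bound) (simp add: gL)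
  have inner_eq: "L2_inner \<Omega> (\<lambda>x. l * u x) f = (LINT x|lebesgue. l * (U x * f x))" for f
    unfolding L2_inner_def using \<Omega>
    by (subst integral_restrict_space)
      (auto intro!: arg_cong[where f="integral\<^sup>L lebesgue"] simp del: integral_mult_right_zero
        simp: U_def indicator_def fun_eq_iff)
  have UU: "integrable lebesgue (\<lambda>x. U x * U x)"
    by (rule continuous_compact_integrable(2)[OF _ Kc]) (auto intro!: continuous_intros Uc simp: U0)
  have uU: "(\<lambda>x. U x * u x) = (\<lambda>x. U x * U x)" by (auto simp: U_def)
  have LUU: "L = l * (LINT x|lebesgue. U x * U x)"
    unfolding L_def inner_eq uU[THEN fun_cong] by simp
  obtain y0 where y0: "y0 \<in> \<Omega>" "u y0 \<noteq> 0" using p by (metis (mono_tags, lifting) closure_empty empty_Collect_eq empty_iff)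
  have "0 < U y0 * U y0" using y0 by (auto simp: U_def zero_less_mult_iff linorder_neq_iff)
  then have "0 < (LINT x|lebesgue. U x * U x)"
    by (rule continuous_integral_pos[OF _ _ _ Kc, rotated 2]) (auto intro!: continuous_intros Uc simp: U0)
  then have L: "0 < L" using \<open>l > 0\<close> LUU by simp
  define \<kappa> where "\<kappa> = L / (2 * \<rho>)"
  define \<delta> where "\<delta> = \<kappa> * (\<rho> / 2)\<^sup>2"
  have \<kappa>: "0 < \<kappa>" and \<delta>: "0 < \<delta>" using L \<rho> by (auto simp: \<kappa>_def \<delta>_def)
  define w where "w x = \<delta> - \<kappa> * (norm (x - p))\<^sup>2" for x
  \<comment> \<open>Positive exactly where the paraboloid lies above \<open>\<sigma> * U\<close>, in
    particular at \<open>p\<close>.\<close>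
  define z where "z x = w x - \<sigma> * U x" for x
  define G where "G x = (if x \<in> \<Omega> then g x else 0)" for x
  \<comment> \<open>The gradient of \<open>z\<close>, set to zero off the ball, where the linear
    term would be unbounded. The bound \<open>2 * L\<close> takes one \<open>L\<close> from
    \<open>w\<close> and one from \<open>g\<close>.\<close>
  define Z where "Z i x = indicator (ball p \<rho>) x * (- (2 * \<kappa> * (x - p) $ i) - \<sigma> * G x $ i)" for i x
  have wc: "continuous_on UNIV w" unfolding w_def by (intro continuous_intros)
  have zc: "continuous_on UNIV z" unfolding z_def by (intro continuous_intros wc Uc)
  have G_meas: "G \<in> borel_measurable lebesgue"
    unfolding G_def by (rule borel_measurable_if_I[OF g_meas \<Omega>])
  have G_bound: "AE x in lebesgue. norm (G x) \<le> L"
  proof -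
    have "AE x in lebesgue. x \<in> \<Omega> \<longrightarrow> norm (g x) \<le> L"
      using g_bound \<Omega> by (subst (asm) AE_restrict_space_iff) auto
    then show ?thesis by eventually_elim (use L in \<open>auto simp: G_def\<close>)
  qed
  have w_grad: "norm ((2 * \<kappa>) *\<^sub>R (x - p)) \<le> L" if "x \<in> cball p \<rho>" for x
  proof -
    have "norm ((2 * \<kappa>) *\<^sub>R (x - p)) = 2 * \<kappa> * norm (x - p)" using \<kappa> by simp
    also have "\<dots> \<le> 2 * \<kappa> * \<rho>" using that \<kappa> by (intro mult_left_mono) (auto simp: dist_norm norm_minus_commute)
    also have "\<dots> = L" using \<rho> by (simp add: \<kappa>_def)
    finally show ?thesis .
  qed
  have wp: "weak_partial i p \<rho> z (Z i) (2 * L)" for i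
  proof
    show "0 < \<rho>" by (rule \<rho>)
    show "0 \<le> 2 * L" using L by simp
    show "continuous_on UNIV z" by (rule zc)
    have m1: "(\<lambda>x. 2 * \<kappa> * (x - p) $ i) \<in> borel_measurable lebesgue"
      by (rule measurable_completion)
        (simp add: borel_measurable_continuous_onI continuous_intros del: vector_minus_component)
    have m2: "(\<lambda>x. G x $ i) \<in> borel_measurable lebesgue"
      using G_meas by (rule measurable_compose) (auto intro!: borel_measurable_continuous_onI continuous_intros)
    show "Z i \<in> borel_measurable lebesgue"
      unfolding Z_def
      by (rule borel_measurable_times[OF borel_measurable_indicator
            borel_measurable_diff[OF borel_measurable_uminus[OF m1]
              borel_measurable_times[OF borel_measurable_const m2]]]) simp
    show "AE x in lebesgue. \<bar>Z i x\<bar> \<le> 2 * L"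
      using G_bound
    proof eventually_elim
      case (elim x)
      have "\<bar>G x $ i\<bar> \<le> L" using elim component_le_norm_cart[of "G x" i] by linarith
      moreover have "\<bar>2 * \<kappa> * (x - p) $ i\<bar> \<le> L" if "x \<in> ball p \<rho>"
        using w_grad[of x] that component_le_norm_cart[of "(2 * \<kappa>) *\<^sub>R (x - p)" i] by auto
      moreover have "\<bar>- (2 * \<kappa> * (x - p) $ i) - \<sigma> * G x $ i\<bar> \<le> \<bar>2 * \<kappa> * (x - p) $ i\<bar> + \<bar>G x $ i\<bar>"
        using abs_triangle_ineq4[of "- (2 * \<kappa> * (x - p) $ i)" "\<sigma> * G x $ i"] \<sigma> by (simp only: abs_mult abs_minus_cancel)
      ultimately show ?case using L unfolding Z_def by (cases "x \<in> ball p \<rho>") (auto simp del: mem_ball)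
    qed
    fix \<psi> assume \<psi>: "\<psi> \<in> test_functions (ball p \<rho>)"
    have \<psi>\<Omega>: "\<psi> \<in> test_functions \<Omega>"
      using \<psi> order_trans[OF ball_subset_cball \<rho>(2)] unfolding test_functions_def by blast
    obtain K where K: "compact K" "K \<subseteq> ball p \<rho>" "\<And>x. x \<notin> K \<Longrightarrow> \<psi> x = 0"
      "\<And>x i. x \<notin> K \<Longrightarrow> partial_deriv i \<psi> x = 0"
      using test_function_support[OF \<psi>] by metis
    note \<psi>c = test_function_continuous[OF \<psi>] test_function_partial_continuous[OF \<psi>, of i]
    have U_weak: "(LINT x|lebesgue. U x * partial_deriv i \<psi> x) = - (LINT x|lebesgue. G x $ i * \<psi> x)"
    proof -
      have "(LINT x|lebesgue_on \<Omega>. u x * partial_deriv i \<psi> x) = - (LINT x|lebesgue_on \<Omega>. g x $ i * \<psi> x)"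
        using g(2)[unfolded is_weak_grad_def, THEN conjunct2, THEN conjunct2, rule_format, OF \<psi>\<Omega>, of i] .
      moreover have "(LINT x|lebesgue_on \<Omega>. u x * partial_deriv i \<psi> x) = (LINT x|lebesgue. U x * partial_deriv i \<psi> x)"
        using \<Omega> by (subst integral_restrict_space)
          (auto intro!: arg_cong[where f="integral\<^sup>L lebesgue"] simp: U_def indicator_def fun_eq_iff)
      moreover have "(LINT x|lebesgue_on \<Omega>. g x $ i * \<psi> x) = (LINT x|lebesgue. G x $ i * \<psi> x)"
        using \<Omega> by (subst integral_restrict_space)
          (auto intro!: arg_cong[where f="integral\<^sup>L lebesgue"] simp: G_def indicator_def fun_eq_iff)
      ultimately show ?thesis by simp
    qed
    have i1: "integrable lebesgue (\<lambda>x. w x * partial_deriv i \<psi> x)"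
      "integrable lebesgue (\<lambda>x. U x * partial_deriv i \<psi> x)"
      "integrable lebesgue (\<lambda>x. - (2 * \<kappa> * (x - p) $ i) * \<psi> x)"
      by (rule continuous_compact_integrable(2)[OF _ K(1)];
          use K(3,4) in \<open>auto intro!: continuous_intros \<psi>c wc Uc\<close>)+
    have i2: "integrable lebesgue (\<lambda>x. G x $ i * \<psi> x)"
    proof (rule integrable_bounded_mult_continuous[OF _ _ \<psi>c(1) K(1,3)])
      show "(\<lambda>x. G x $ i) \<in> borel_measurable lebesgue" by fact
      show "AE x in lebesgue. \<bar>G x $ i\<bar> \<le> L"
        using G_bound by eventually_elim (use component_le_norm_cart order_trans in blast)
    qed
    have "(LINT x|lebesgue. z x * partial_deriv i \<psi> x) =
        (LINT x|lebesgue. w x * partial_deriv i \<psi> x - \<sigma> * (U x * partial_deriv i \<psi> x))"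
      by (simp add: z_def algebra_simps)
    also have "\<dots> = (LINT x|lebesgue. w x * partial_deriv i \<psi> x) - \<sigma> * (LINT x|lebesgue. U x * partial_deriv i \<psi> x)"
      using i1 by simp
    also have "\<dots> = - ((LINT x|lebesgue. - (2 * \<kappa> * (x - p) $ i) * \<psi> x) - \<sigma> * (LINT x|lebesgue. G x $ i * \<psi> x))"
      using U_weak quadratic_weak_partial[OF \<psi>, where \<delta>=\<delta> and \<kappa>=\<kappa> and p=p and i=i] by (simp add: w_def)
    also have "(LINT x|lebesgue. - (2 * \<kappa> * (x - p) $ i) * \<psi> x) - \<sigma> * (LINT x|lebesgue. G x $ i * \<psi> x) =
        (LINT x|lebesgue. - (2 * \<kappa> * (x - p) $ i) * \<psi> x - \<sigma> * (G x $ i * \<psi> x))"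
      by (subst Bochner_Integration.integral_diff[OF i1(3)]) (use i2 in auto)
    also have "(\<lambda>x. - (2 * \<kappa> * (x - p) $ i) * \<psi> x - \<sigma> * (G x $ i * \<psi> x)) = (\<lambda>x. Z i x * \<psi> x)"
    proof
      fix x show "- (2 * \<kappa> * (x - p) $ i) * \<psi> x - \<sigma> * (G x $ i * \<psi> x) = Z i x * \<psi> x"
        using K(2) K(3)[of x] by (cases "x \<in> K") (auto simp: Z_def algebra_simps simp del: mem_ball)
    qed
    finally show "(LINT x|lebesgue. z x * partial_deriv i \<psi> x) = - (LINT x|lebesgue. Z i x * \<psi> x)" .
  qed
  have \<sigma>U: "0 \<le> \<sigma> * U x" if "x \<in> cball p \<rho>" for x
    using sign[OF that] \<rho>(2) that by (auto simp: U_def)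
  have zneg: "z x \<le> 0" if "x \<in> ball p \<rho>" "x \<notin> ball p (\<rho> / 2)" for x
  proof -
    have "(\<rho> / 2)\<^sup>2 \<le> (norm (x - p))\<^sup>2"
      using that(2) \<rho> by (intro power_mono) (auto simp: dist_norm norm_minus_commute)
    then have "w x \<le> 0" using \<kappa> by (simp add: w_def \<delta>_def)
    then show ?thesis using \<sigma>U[of x] that(1) by (auto simp: z_def)
  qed
  define c where "c = 1 / (2 * \<delta>)"
  have c: "0 < c" using \<delta> by (simp add: c_def)
  \<comment> \<open>The excess of the smoothed maximum over \<open>\<sigma> * u\<close>. The cutoff
    is needed because far from \<open>p\<close> the sign of \<open>\<sigma> * U\<close> is unknown,
    so \<open>z\<close> could be positive again.\<close>
  define \<phi> where "\<phi> = (\<lambda>x. if x \<in> cball p (\<rho> / 2) then c * (max 0 (z x))\<^sup>2 else 0)"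
  define \<phi>' where "\<phi>' = (\<lambda>x. if x \<in> cball p (\<rho> / 2) then 2 * c * max 0 (z x) else 0)"
  have sphere: "z x \<le> 0" if "dist p x = \<rho> / 2" for x
    using zneg[of x] that \<rho> by simp
  have \<phi>c: "continuous_on UNIV \<phi>" and \<phi>'c: "continuous_on UNIV \<phi>'"
    unfolding \<phi>_def \<phi>'_def
    by (intro continuous_on_cutoff continuous_intros zc; use sphere in force)+
  have half: "cball p (\<rho> / 2) \<subseteq> \<Omega>" "cball p (\<rho> / 2) \<subseteq> ball p \<rho>" using \<rho> by auto
  have \<phi>0: "\<phi> x = 0" "\<phi>' x = 0" if "x \<notin> cball p (\<rho> / 2)" for x
    using that by (auto simp: \<phi>_def \<phi>'_def)
  have \<phi>'01: "0 \<le> \<phi>' x" "\<phi>' x \<le> 1" for x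
  proof -
    show "0 \<le> \<phi>' x" using c by (simp add: \<phi>'_def)
    show "\<phi>' x \<le> 1"
    proof (cases "x \<in> cball p (\<rho> / 2)")
      case True
      then have "0 \<le> \<sigma> * U x" using \<sigma>U[of x] \<rho> by auto
      moreover have "0 \<le> \<kappa> * (norm (x - p))\<^sup>2" using \<kappa> by simp
      ultimately have "z x \<le> \<delta>" unfolding z_def w_def by linarith
      then have "2 * c * max 0 (z x) \<le> 2 * c * \<delta>" using c \<delta> by (intro mult_left_mono) auto
      also have "\<dots> = 1" using \<delta> by (simp add: c_def)
      finally show ?thesis using True by (simp add: \<phi>'_def)
    qed (simp add: \<phi>0)
  qed
  define v where "v x = u x + \<sigma> * \<phi> x" for x
  \<comment> \<open>As the gradient of \<open>w\<close> is \<open>- 2 * \<kappa> * (x - p)\<close>,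
    this is the convex combination of \<open>g\<close> and \<open>\<sigma>\<close> times the
    gradient of \<open>w\<close>, with weights \<open>1 - \<phi>' x\<close> and
    \<open>\<phi>' x\<close>.\<close>
  define H where "H x = (1 - \<phi>' x) *\<^sub>R g x - (\<sigma> * \<phi>' x) *\<^sub>R ((2 * \<kappa>) *\<^sub>R (x - p))" for x
  have \<phi>_meas: "\<phi> \<in> borel_measurable (lebesgue_on \<Omega>)" "\<phi>' \<in> borel_measurable (lebesgue_on \<Omega>)"
    using \<phi>c \<phi>'c \<Omega> continuous_on_subset
    by (auto intro!: continuous_imp_measurable_on_sets_lebesgue)
  have H_meas: "H \<in> borel_measurable (lebesgue_on \<Omega>)"
  proof -
    have m: "(\<lambda>x. (2 * \<kappa>) *\<^sub>R (x - p)) \<in> borel_measurable (lebesgue_on \<Omega>)"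
      using \<Omega> by (intro continuous_imp_measurable_on_sets_lebesgue continuous_intros)
    show ?thesis unfolding H_def
      by (intro borel_measurable_diff[OF borel_measurable_scaleR[OF _ g_meas] borel_measurable_scaleR[OF _ m]]
          borel_measurable_diff borel_measurable_times borel_measurable_const \<phi>_meas)
  qed
  have H_bound: "AE x in lebesgue_on \<Omega>. norm (H x) \<le> L"
    using g_bound
  proof eventually_elim
    case (elim x)
    have "norm (H x) \<le> (1 - \<phi>' x) * norm (g x) + \<phi>' x * norm ((2 * \<kappa>) *\<^sub>R (x - p))"
      unfolding H_def using \<phi>'01[of x] \<sigma> norm_triangle_ineq4[of "(1 - \<phi>' x) *\<^sub>R g x" "(\<sigma> * \<phi>' x) *\<^sub>R ((2 * \<kappa>) *\<^sub>R (x - p))"]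
      by (simp add: abs_mult)
    also have "\<dots> \<le> (1 - \<phi>' x) * L + \<phi>' x * L"
    proof (rule add_mono)
      show "(1 - \<phi>' x) * norm (g x) \<le> (1 - \<phi>' x) * L"
        using elim \<phi>'01(2)[of x] by (intro mult_left_mono) auto
      show "\<phi>' x * norm ((2 * \<kappa>) *\<^sub>R (x - p)) \<le> \<phi>' x * L"
      proof (cases "x \<in> cball p (\<rho> / 2)")
        case True
        then show ?thesis using w_grad[of x] \<phi>'01(1)[of x] \<rho> by (intro mult_left_mono) auto
      qed (simp add: \<phi>0)
    qed
    finally show ?case by (simp add: algebra_simps)
  qed
  have v_meas: "v \<in> borel_measurable (lebesgue_on \<Omega>)"
    unfolding v_def
    by (rule borel_measurable_add[OF u_meas borel_measurable_times[OF borel_measurable_const \<phi>_meas(1)]])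
  define W where "W x = U x + \<sigma> * \<phi> x" for x
  have Wc: "continuous_on UNIV W" unfolding W_def by (intro continuous_intros Uc \<phi>c)
  have vW: "v x = W x" if "x \<in> \<Omega>" for x using that by (simp add: v_def W_def U_def)
  have W0: "W x = 0" if "x \<notin> \<Omega>" for x using that half(1) by (auto simp: W_def U_def \<phi>_def)
  have W0': "W x = 0" if "x \<notin> closure \<Omega>" for x using that closure_subset[of \<Omega>] by (auto intro: W0)
  have "bounded (W ` closure \<Omega>)"
    by (intro compact_imp_bounded compact_continuous_image Kc continuous_on_subset[OF Wc]) simp
  then obtain B where B': "0 < B" "\<And>x. x \<in> closure \<Omega> \<Longrightarrow> \<bar>W x\<bar> \<le> B" by (auto simp: bounded_pos)
  have B: "\<bar>W x\<bar> \<le> B" for x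
    using B'(1) B'(2)[of x] W0'[of x] by (cases "x \<in> closure \<Omega>") auto
  have v_bound: "AE x in lebesgue_on \<Omega>. norm (v x) \<le> B"
    using B \<Omega> by (subst AE_restrict_space_iff) (auto simp: vW)
  have v_grad: "is_weak_grad \<Omega> v H"
    unfolding is_weak_grad_def
  proof (intro conjI ballI allI)
    show vl: "locally_integrable \<Omega> v" by (rule Linf_locally_integrable[OF \<open>open \<Omega>\<close> v_meas v_bound])
    show "locally_integrable \<Omega> H" by (rule Linf_locally_integrable[OF \<open>open \<Omega>\<close> H_meas H_bound])
    fix \<psi> i assume \<psi>: "\<psi> \<in> test_functions \<Omega>"
    obtain K where K: "compact K" "K \<subseteq> \<Omega>" "\<And>x. x \<notin> K \<Longrightarrow> \<psi> x = 0"
      "\<And>x i. x \<notin> K \<Longrightarrow> partial_deriv i \<psi> x = 0"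
      using test_function_support[OF \<psi>] by metis
    note \<psi>c = test_function_continuous[OF \<psi>] test_function_partial_continuous[OF \<psi>, of i]
    interpret weak_partial i p \<rho> z "Z i" "2 * L" by (rule wp)
    have restr: "(LINT x|lebesgue. f x) = (LINT x|lebesgue_on \<Omega>. f x)" if "\<And>x. x \<notin> \<Omega> \<Longrightarrow> f x = 0" for f :: "real^'n \<Rightarrow> real"
    proof -
      have "(\<lambda>x. indicator \<Omega> x *\<^sub>R f x) = f" using that by (auto simp: indicator_def fun_eq_iff)
      then show ?thesis using integral_restrict_space[of \<Omega> lebesgue f] \<Omega> by simp
    qed
    have on_\<Omega>: "integrable (lebesgue_on \<Omega>) f" if "integrable lebesgue f" for f :: "real^'n \<Rightarrow> real"
      using integrable_mult_indicator[OF \<Omega> that] \<Omega> by (subst integrable_restrict_space) simp_all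
    have chain: "(LINT x|lebesgue. \<phi> x * partial_deriv i \<psi> x) = - (LINT x|lebesgue. \<phi>' x * Z i x * \<psi> x)"
      unfolding \<phi>_def \<phi>'_def
      by (rule weak_chain_rule_square_positive_part[OF _ zneg \<psi>]) (use c in auto)
    have i1: "integrable (lebesgue_on \<Omega>) (\<lambda>x. u x * partial_deriv i \<psi> x)"
      using g(2) by (intro integrable_locally_mult[OF \<open>open \<Omega>\<close> _ \<psi>c(2) K(1,2,4)]) (simp add: is_weak_grad_def)
    have i2: "integrable (lebesgue_on \<Omega>) (\<lambda>x. g x $ i * \<psi> x)"
      using g(2) by (intro integrable_locally_mult[OF \<open>open \<Omega>\<close> _ \<psi>c(1) K(1,2,3)] locally_integrable_component)
        (simp add: is_weak_grad_def)
    have "integrable lebesgue (\<lambda>x. Z i x * (\<phi>' x * \<psi> x))"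
      by (rule integrable_bounded_mult_continuous[OF Z _ K(1)]) (use K(3) in \<open>auto intro!: continuous_intros \<phi>'c \<psi>c\<close>)
    then have "integrable lebesgue (\<lambda>x. \<phi>' x * Z i x * \<psi> x)" by (simp add: mult_ac)
    then have i3: "integrable (lebesgue_on \<Omega>) (\<lambda>x. \<phi>' x * Z i x * \<psi> x)"
      by (rule on_\<Omega>)
    have i4: "integrable (lebesgue_on \<Omega>) (\<lambda>x. \<phi> x * partial_deriv i \<psi> x)"
      by (intro on_\<Omega> continuous_compact_integrable(2)[OF _ K(1)])
        (use K(4) in \<open>auto intro!: continuous_intros \<phi>c \<psi>c\<close>)
    have "(LINT x|lebesgue_on \<Omega>. v x * partial_deriv i \<psi> x) =
        (LINT x|lebesgue_on \<Omega>. u x * partial_deriv i \<psi> x + \<sigma> * (\<phi> x * partial_deriv i \<psi> x))"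
      by (simp add: v_def algebra_simps)
    also have "\<dots> = (LINT x|lebesgue_on \<Omega>. u x * partial_deriv i \<psi> x) + \<sigma> * (LINT x|lebesgue_on \<Omega>. \<phi> x * partial_deriv i \<psi> x)"
      using i1 i4 by simp
    also have "(LINT x|lebesgue_on \<Omega>. u x * partial_deriv i \<psi> x) = - (LINT x|lebesgue_on \<Omega>. g x $ i * \<psi> x)"
      using g(2)[unfolded is_weak_grad_def, THEN conjunct2, THEN conjunct2, rule_format, OF \<psi>, of i] .
    also have "(LINT x|lebesgue_on \<Omega>. \<phi> x * partial_deriv i \<psi> x) = - (LINT x|lebesgue_on \<Omega>. \<phi>' x * Z i x * \<psi> x)"
    proof -
      have "\<psi> x = 0" "partial_deriv i \<psi> x = 0" if "x \<notin> \<Omega>" for x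
        using that K(2) K(3)[of x] K(4)[of x i] by auto
      then show ?thesis using chain restr[of "\<lambda>x. \<phi> x * partial_deriv i \<psi> x"]
          restr[of "\<lambda>x. \<phi>' x * Z i x * \<psi> x"] by simp
    qed
    also have "- (LINT x|lebesgue_on \<Omega>. g x $ i * \<psi> x) + \<sigma> * - (LINT x|lebesgue_on \<Omega>. \<phi>' x * Z i x * \<psi> x) =
        - (LINT x|lebesgue_on \<Omega>. g x $ i * \<psi> x + \<sigma> * (\<phi>' x * Z i x * \<psi> x))"
      using i2 i3 by simp
    also have "(LINT x|lebesgue_on \<Omega>. g x $ i * \<psi> x + \<sigma> * (\<phi>' x * Z i x * \<psi> x)) = (LINT x|lebesgue_on \<Omega>. H x $ i * \<psi> x)"
    proof (rule Bochner_Integration.integral_cong[OF refl])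
      fix x assume "x \<in> space (lebesgue_on \<Omega>)"
      then have x: "x \<in> \<Omega>" by simp
      \<comment> \<open>The increment of the gradient is \<open>\<sigma> * \<phi>'\<close> times the
        gradient of \<open>w - \<sigma> * u\<close>; \<open>\<sigma> * \<sigma> = 1\<close> removes
        the sign from the \<open>g\<close> term.\<close>
      have "\<sigma> * \<phi>' x * Z i x = - (\<sigma> * \<phi>' x) * (2 * \<kappa> * (x - p) $ i) - \<phi>' x * g x $ i"
      proof (cases "x \<in> cball p (\<rho> / 2)")
        case True
        then have "Z i x = - (2 * \<kappa> * (x - p) $ i) - \<sigma> * g x $ i"
          using half(2) x by (auto simp: Z_def G_def)
        then have "\<sigma> * \<phi>' x * Z i x = - (\<sigma> * \<phi>' x) * (2 * \<kappa> * (x - p) $ i) - (\<sigma> * \<sigma>) * (\<phi>' x * g x $ i)"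
          by (simp only:) (simp add: algebra_simps)
        then show ?thesis by (simp add: \<sigma>2)
      qed (simp add: \<phi>0)
      then have "H x $ i = g x $ i + \<sigma> * \<phi>' x * Z i x"
        by (simp add: H_def algebra_simps)
      then show "g x $ i * \<psi> x + \<sigma> * (\<phi>' x * Z i x * \<psi> x) = H x $ i * \<psi> x"
        by (simp add: algebra_simps)
    qed
    finally show "(LINT x|lebesgue_on \<Omega>. v x * partial_deriv i \<psi> x) = - (LINT x|lebesgue_on \<Omega>. H x $ i * \<psi> x)" .
  qed
  have "v \<in> W01inf \<Omega>"
    unfolding W01inf_def W1inf_def
  proof (intro CollectI conjI bexI[of _ H] ballI)
    show "v \<in> Linf \<Omega>" by (rule LinfI[OF v_meas v_bound])
    show "H \<in> Linf \<Omega>" by (rule LinfI[OF H_meas H_bound])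
    show "is_weak_grad \<Omega> v H" by (rule v_grad)
    show "continuous_on (closure \<Omega>) v"
      unfolding v_def using u by (intro continuous_intros continuous_on_subset[OF \<phi>c]) (auto simp: W01inf_def)
    show "v x = 0" if "x \<in> frontier \<Omega>" for x
    proof -
      have "x \<notin> \<Omega>" using that \<open>open \<Omega>\<close> by (simp add: frontier_def interior_open)
      then show ?thesis using that u half(1) by (auto simp: v_def W01inf_def \<phi>_def)
    qed
  qed
  then have "J_fun \<Omega> v = Linf_norm \<Omega> (weak_grad \<Omega> v)" by (auto simp: J_fun_def)
  also have "\<dots> = Linf_norm \<Omega> H"
    by (rule Linf_norm_weak_grad[OF \<open>open \<Omega>\<close> v_grad LinfI(1)[OF H_meas H_bound]])
  also have "\<dots> \<le> ereal L" by (rule LinfI(2)[OF H_meas H_bound])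
  finally have Jv: "J_fun \<Omega> v \<le> ereal L" .
  have "v \<in> L2 \<Omega>"
    unfolding L2_def
  proof (intro CollectI conjI v_meas)
    have "integrable lebesgue (\<lambda>x. W x * W x)"
      by (rule continuous_compact_integrable(2)[OF _ Kc]) (auto intro!: continuous_intros Wc simp: W0')
    also have "(\<lambda>x. W x * W x) = (\<lambda>x. indicator \<Omega> x *\<^sub>R (norm (v x))\<^sup>2)"
      by (auto simp: fun_eq_iff indicator_def vW W0 power2_eq_square)
    finally show "integrable (lebesgue_on \<Omega>) (\<lambda>x. (norm (v x))\<^sup>2)"
      using \<Omega> by (subst integrable_restrict_space) auto
  qed
  then have "ereal (L2_inner \<Omega> (\<lambda>x. l * u x) v) \<le> ereal L"
    using sub Jv order_trans unfolding subdiff_J_def by blast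
  \<comment> \<open>Since \<open>L\<close> is also the pairing with \<open>u\<close>, the term
    contributed by \<open>\<sigma> * \<phi>\<close> cannot be positive.\<close>
  then have le: "L2_inner \<Omega> (\<lambda>x. l * u x) v \<le> L" by simp
  have \<phi>U: "integrable lebesgue (\<lambda>x. \<sigma> * U x * \<phi> x)"
    by (rule continuous_compact_integrable(2)[OF _ Kc]) (auto intro!: continuous_intros Uc \<phi>c simp: U0)
  have "L2_inner \<Omega> (\<lambda>x. l * u x) v = (LINT x|lebesgue. l * (U x * U x + \<sigma> * U x * \<phi> x))"
    unfolding inner_eq by (rule Bochner_Integration.integral_cong) (auto simp: v_def U_def algebra_simps)
  also have "\<dots> = L + l * (LINT x|lebesgue. \<sigma> * U x * \<phi> x)"
    using UU \<phi>U by (simp add: LUU distrib_left)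
  finally have "(LINT x|lebesgue. \<sigma> * U x * \<phi> x) \<le> 0"
    using le \<open>l > 0\<close> by (simp add: mult_le_0_iff)
  moreover have "0 < (LINT x|lebesgue. \<sigma> * U x * \<phi> x)"
  proof -
    have "U p = 0" using \<open>u p = 0\<close> by (simp add: U_def)
    then have "z p > 0" using \<delta> by (simp add: z_def w_def)
    moreover have "open {x. 0 < z x}" by (intro open_Collect_less continuous_intros zc)
    ultimately have "open ({x. 0 < z x} \<inter> ball p (\<rho> / 2))" "p \<in> {x. 0 < z x} \<inter> ball p (\<rho> / 2)"
      using \<rho> by auto
    \<comment> \<open>The set \<open>z > 0\<close> is a neighbourhood of \<open>p\<close>, and
      \<open>p\<close> is a limit of points with \<open>u\<close> nonzero; at a common point both
      factors \<open>\<sigma> * U\<close> and \<open>\<phi>\<close> are strictly positive.\<close>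
    then obtain y where y: "0 < z y" "y \<in> ball p (\<rho> / 2)" "y \<in> \<Omega>" "u y \<noteq> 0"
      using p unfolding closure_iff_nhds_not_empty by blast
    show ?thesis
    proof (rule continuous_integral_pos[OF _ _ _ Kc, of _ y])
      show "continuous_on UNIV (\<lambda>x. \<sigma> * U x * \<phi> x)" by (intro continuous_intros Uc \<phi>c)
      show "0 \<le> \<sigma> * U x * \<phi> x" for x
      proof (cases "x \<in> cball p (\<rho> / 2)")
        case True
        then show ?thesis using \<sigma>U[of x] c \<rho> by (auto simp: \<phi>_def intro!: mult_nonneg_nonneg)
      qed (simp add: \<phi>0)
      have "\<sigma> * U y \<noteq> 0" using y \<sigma> by (auto simp: U_def)
      moreover have "0 \<le> \<sigma> * U y" using \<sigma>U[of y] y(2) \<rho> by auto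
      ultimately have "0 < \<sigma> * U y" by linarith
      moreover have "0 < \<phi> y" using y(1,2) c by (simp add: \<phi>_def)
      ultimately show "0 < \<sigma> * U y * \<phi> y" by simp
      show "\<sigma> * U x * \<phi> x = 0" if "x \<notin> closure \<Omega>" for x using U0[OF that] by simp
    qed
  qed
  ultimately show False by simp
qed

section \<open>Constant sign near a Lipschitz boundary point\<close>

text \<open>Any two points of \<open>A\<close> near \<open>p\<close> are joined inside
  \<open>A\<close> by climbing in direction \<open>e\<close>, crossing high above the graph, and
  descending. Since \<open>u\<close> has no zero on \<open>A\<close>, the intermediate value theorem
  forbids a change of sign along this path.\<close>

lemma lipschitz_boundary_local_sign:
  fixes A :: "(real^'n::finite) set" and u :: "real^'n \<Rightarrow> real"
  assumes "lipschitz_boundary A" "p \<in> frontier A" "continuous_on A u" "\<And>x. x \<in> A \<Longrightarrow> u x \<noteq> 0"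
  obtains \<rho> \<sigma> where "0 < \<rho>" "\<bar>\<sigma>\<bar> = 1" "\<And>x. x \<in> A \<Longrightarrow> x \<in> ball p \<rho> \<Longrightarrow> 0 < \<sigma> * u x"
proof -
  obtain r e \<gamma> C where r: "r > 0" and e: "norm e = 1" and lip: "C-lipschitz_on {z. z \<bullet> e = 0} \<gamma>"
    and A: "A \<inter> ball p r = {y \<in> ball p r. \<gamma> (y - (y \<bullet> e) *\<^sub>R e) < y \<bullet> e}"
    using assms(1)[unfolded lipschitz_boundary_def, rule_format, OF assms(2)] by blast
  have C: "0 \<le> C" using lip by (rule lipschitz_on_nonneg)
  define P where "P y = y - (y \<bullet> e) *\<^sub>R e" for y
  have ee: "e \<bullet> e = 1" using e by (simp add: dot_square_norm)
  have P0: "P y \<bullet> e = 0" for y by (simp add: P_def inner_diff_left ee)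
  have inA: "y \<in> A" if "y \<in> ball p r" "\<gamma> (P y) < y \<bullet> e" for y using that A by (auto simp: P_def)
  have same_sign: "0 < u a * u b" if "closed_segment a b \<subseteq> A" for a b
  proof (rule ccontr)
    assume "\<not> 0 < u a * u b"
    then have "u a \<le> 0 \<and> 0 \<le> u b \<or> u b \<le> 0 \<and> 0 \<le> u a" by (auto simp: not_less mult_le_0_iff)
    moreover have conn: "connected (u ` closed_segment a b)"
      using that by (intro connected_continuous_image continuous_on_subset[OF assms(3)]) auto
    have "u a \<in> u ` closed_segment a b" "u b \<in> u ` closed_segment a b" by auto
    then have "{u a..u b} \<subseteq> u ` closed_segment a b" "{u b..u a} \<subseteq> u ` closed_segment a b"
      using connected_contains_Icc[OF conn] by blast+
    ultimately have "0 \<in> u ` closed_segment a b" by auto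
    then show False using that assms(4) by auto
  qed
  \<comment> \<open>While crossing, the projection moves by at most \<open>4 * \<rho>\<close>, so
    the graph rises by at most \<open>4 * C * \<rho>\<close>, and the height drops by at most
    \<open>2 * \<rho>\<close>. The climb \<open>T\<close> is the sum of these two, and
    \<open>\<rho>\<close> is small enough for \<open>\<rho> + T < r\<close>.\<close>
  define \<rho> where "\<rho> = r / (4 * C + 4)"
  define T where "T = (4 * C + 2) * \<rho>"
  have \<rho>: "0 < \<rho>" using r C by (simp add: \<rho>_def)
  have T: "0 \<le> T" using C \<rho> by (simp add: T_def)
  have rT: "\<rho> + T < r"
  proof -
    have "r = (4 * C + 4) * \<rho>" using C by (simp add: \<rho>_def)
    also have "\<dots> = \<rho> + T + \<rho>" by (simp add: T_def algebra_simps)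
    finally show ?thesis using \<rho> by simp
  qed
  have main: "0 < u y1 * u y2" if y: "y1 \<in> A" "y1 \<in> ball p \<rho>" "y2 \<in> A" "y2 \<in> ball p \<rho>" for y1 y2
  proof -
    have up_ball: "y + s *\<^sub>R e \<in> ball p r" if "y \<in> ball p \<rho>" "0 \<le> s" "s \<le> T" for y s
    proof -
      have "dist p (y + s *\<^sub>R e) \<le> dist p y + s"
        using norm_triangle_ineq4[of "p - y" "s *\<^sub>R e"] e that(2) by (simp add: dist_norm algebra_simps)
      then show ?thesis using that rT by simp
    qed
    have up: "0 < u y * u (y + T *\<^sub>R e)" and gam: "\<gamma> (P y) < y \<bullet> e" if yA: "y \<in> A" "y \<in> ball p \<rho>" for y
    proof -
      have "y \<in> A \<inter> ball p r" using yA rT T by auto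
      then show g: "\<gamma> (P y) < y \<bullet> e" unfolding A by (simp add: P_def)
      show "0 < u y * u (y + T *\<^sub>R e)"
      proof (rule same_sign, rule subsetI)
        fix x assume "x \<in> closed_segment y (y + T *\<^sub>R e)"
        then obtain s where s: "0 \<le> s" "s \<le> 1" "x = (1 - s) *\<^sub>R y + s *\<^sub>R (y + T *\<^sub>R e)"
          by (auto simp: in_segment)
        \<comment> \<open>Moving along \<open>e\<close> leaves the projection, and hence the height
          of the graph, unchanged, so the climb cannot leave the epigraph.\<close>
        then have x: "x = y + (s * T) *\<^sub>R e" by (simp add: algebra_simps)
        have sT: "0 \<le> s * T" "s * T \<le> T" using s T mult_right_mono[of s 1 T] by simp_all
        have "P x = P y" unfolding x P_def by (simp add: inner_add_left ee algebra_simps)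
        moreover have "x \<bullet> e = y \<bullet> e + s * T" unfolding x by (simp add: inner_add_left ee)
        ultimately show "x \<in> A" using g sT up_ball[OF yA(2) sT] x by (intro inA) auto
      qed
    qed
    have across: "0 < u (y1 + T *\<^sub>R e) * u (y2 + T *\<^sub>R e)"
    proof (rule same_sign, rule subsetI)
      fix x assume xs: "x \<in> closed_segment (y1 + T *\<^sub>R e) (y2 + T *\<^sub>R e)"
      then obtain s where s: "0 \<le> s" "s \<le> 1" "x = (1 - s) *\<^sub>R (y1 + T *\<^sub>R e) + s *\<^sub>R (y2 + T *\<^sub>R e)"
        by (auto simp: in_segment)
      then have x: "x = y1 + T *\<^sub>R e + s *\<^sub>R (y2 - y1)" by (simp add: algebra_simps)
      have d: "norm (y2 - y1) \<le> 2 * \<rho>"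
        using y(2,4) norm_triangle_ineq4[of "p - y1" "p - y2"] by (simp add: dist_norm)
      have cs: "\<bar>(y2 - y1) \<bullet> e\<bar> \<le> norm (y2 - y1)"
        using Cauchy_Schwarz_ineq2[of "y2 - y1" e] e by simp
      have "P x - P y1 = s *\<^sub>R ((y2 - y1) - ((y2 - y1) \<bullet> e) *\<^sub>R e)"
        unfolding x P_def by (simp add: inner_add_left inner_diff_left ee algebra_simps)
      then have "norm (P x - P y1) = s * norm ((y2 - y1) - ((y2 - y1) \<bullet> e) *\<^sub>R e)"
        using s(1) by simp
      also have "\<dots> \<le> 1 * (norm (y2 - y1) + norm (((y2 - y1) \<bullet> e) *\<^sub>R e))"
        using s by (intro mult_mono norm_triangle_ineq4) auto
      also have "\<dots> \<le> 4 * \<rho>" using cs d e by simp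
      finally have "dist (P x) (P y1) \<le> 4 * \<rho>" by (simp add: dist_norm)
      then have "dist (\<gamma> (P x)) (\<gamma> (P y1)) \<le> C * (4 * \<rho>)"
        using lipschitz_onD[OF lip, of "P x" "P y1"] P0 C mult_left_mono[of "dist (P x) (P y1)" "4 * \<rho>" C] by simp
      then have g: "\<gamma> (P x) < y1 \<bullet> e + 4 * C * \<rho>"
        using gam[OF y(1,2)] by (simp add: dist_real_def abs_le_iff)
      have "\<bar>s * ((y2 - y1) \<bullet> e)\<bar> \<le> 1 * (2 * \<rho>)"
        unfolding abs_mult using s cs d by (intro mult_mono) auto
      moreover have "x \<bullet> e = y1 \<bullet> e + T + s * ((y2 - y1) \<bullet> e)"
        unfolding x by (simp add: inner_add_left ee)
      moreover have "T = 4 * C * \<rho> + 2 * \<rho>" by (simp add: T_def algebra_simps)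
      ultimately have "\<gamma> (P x) < x \<bullet> e" using g by linarith
      moreover have "x \<in> ball p r"
        using closed_segment_subset[OF up_ball up_ball convex_ball, OF y(2) T order_refl y(4) T order_refl] xs by blast
      ultimately show "x \<in> A" by (intro inA)
    qed
    show ?thesis
      using up[OF y(1,2)] up[OF y(3,4)] across by (auto simp: zero_less_mult_iff)
  qed
  have "p \<in> closure A" using assms(2) by (simp add: frontier_def)
  then obtain y0 where y0: "y0 \<in> A" "y0 \<in> ball p \<rho>"
    using \<rho> unfolding closure_approachable by (auto simp: dist_commute)
  show thesis
  proof
    show "0 < \<rho>" by (rule \<rho>)
    show "\<bar>sgn (u y0)\<bar> = 1" using assms(4)[OF y0(1)] by (simp add: abs_sgn_eq)
    show "0 < sgn (u y0) * u x" if "x \<in> A" "x \<in> ball p \<rho>" for x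
      using main[OF y0 that] by (auto simp: sgn_real_def zero_less_mult_iff)
  qed
qed

theorem proposition2p13:
  fixes \<Omega> :: "(real^'n::finite) set"
    and u :: "real^'n \<Rightarrow> real"
    and q :: "real^'n \<Rightarrow> real^'n"
    and l :: real
  assumes "open \<Omega>" and "connected \<Omega>" and "bounded \<Omega>"
    and "u \<in> W01inf \<Omega>" and "\<exists>x\<in>\<Omega>. u x \<noteq> 0"
    and "l > 0" and "(\<lambda>x. l * u x) \<in> subdiff_J \<Omega> u"
    and "q \<in> H_div \<Omega>" and "is_weak_div \<Omega> q (\<lambda>x. - (l * u x))"
    and "L1_norm \<Omega> q = 1"
    and "lipschitz_boundary {x \<in> \<Omega>. u x \<noteq> 0}"
  shows "{x \<in> \<Omega>. u x = 0} \<in> null_sets lebesgue"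
proof -
  let ?A = "{x \<in> \<Omega>. u x \<noteq> 0}"
  have uc: "continuous_on \<Omega> u"
    using assms(4) closure_subset continuous_on_subset unfolding W01inf_def by blast
  have Aopen: "open ?A"
  proof -
    have "open (\<Omega> \<inter> u -` (- {0}))"
      using uc \<open>open \<Omega>\<close> by (intro continuous_open_preimage) auto
    also have "\<Omega> \<inter> u -` (- {0}) = ?A" by auto
    finally show ?thesis .
  qed
  \<comment> \<open>As \<open>?A\<close> is open, a frontier point inside \<open>\<Omega>\<close>
    would be a zero of \<open>u\<close> that is a limit of nonzeros, and zeros do not spoil the weak
    inequality \<open>0 \<le> \<sigma> * u x\<close> around it.\<close>
  have "\<Omega> \<inter> frontier ?A = {}"
  proof (rule ccontr)
    assume "\<Omega> \<inter> frontier ?A \<noteq> {}"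
    then obtain p where p: "p \<in> \<Omega>" "p \<in> frontier ?A" by auto
    have pA: "p \<notin> ?A" "p \<in> closure ?A" using p(2) Aopen by (auto simp: frontier_def interior_open)
    obtain \<rho> \<sigma> where \<rho>: "0 < \<rho>" "\<bar>\<sigma>\<bar> = 1" "\<And>x. x \<in> ?A \<Longrightarrow> x \<in> ball p \<rho> \<Longrightarrow> 0 < \<sigma> * u x"
      using lipschitz_boundary_local_sign[OF assms(11) p(2) continuous_on_subset[OF uc]] by blast
    obtain \<rho>' where \<rho>': "0 < \<rho>'" "cball p \<rho>' \<subseteq> \<Omega> \<inter> ball p \<rho>"
      using \<open>open \<Omega>\<close> p(1) \<rho>(1)
        open_contains_cball[THEN iffD1, rule_format, of "\<Omega> \<inter> ball p \<rho>" p] by force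
    show False
    proof (rule eigenfunction_no_one_sided_zero[OF assms(1,3,4,6,7) \<rho>(2) \<rho>'(1)])
      show "cball p \<rho>' \<subseteq> \<Omega>" using \<rho>'(2) by blast
      show "u p = 0" using p(1) pA(1) by simp
      show "0 \<le> \<sigma> * u x" if "x \<in> cball p \<rho>'" for x
      proof (cases "u x = 0")
        case False
        then show ?thesis using that \<rho>'(2) \<rho>(3)[of x] by force
      qed simp
    qed (rule pA(2))
  qed
  then have "\<Omega> - ?A = {}"
    using connected_Int_frontier[OF \<open>connected \<Omega>\<close>, of ?A] assms(5) by blast
  then have "{x \<in> \<Omega>. u x = 0} = {}" by blast
  then show ?thesis by (simp only: null_sets.empty_sets)
qed

end
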